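(* Let $s\geq 2$ and $n\geq 1$ be integers, and let $\Gamma$ be a co-edge-regular graph with spectrum $$\{(2sn-3s-1)^1,\ (sn-3s-1)^{n-1},\ (-s-1)^{\frac{n^2-3n}{2}},\ (-1)^{\frac{(s-1)n(n-1)}{2}}\}.$$ If $n\geq 48s$, then $\Gamma$ is (isomorphic to) the $s$-clique extension of the triangular graph $T(n)$.
   Context: All graphs are finite, simple and undirected. The spectrum of a graph is the multiset of eigenvalues of its adjacency matrix; $\theta^m$ denotes the eigenvalue $\theta$ with multiplicity $m$. A regular graph is co-edge-regular if there is a constant $\mu$ such that any two distinct non-adjacent vertices have exactly $\mu$ common neighbors. The triangular graph $T(n)$ has as vertices the $2$-subsets of an $n$-set, two being adjacent when they share exactly one element. The $s$-clique extension of a graph $G$ is the graph obtained from $G$ by replacing each vertex $x$ by a clique $\widetilde{X}$ on $s$ vertices, where for distinct vertices $x,y$ of $G$, each vertex of $\widetilde{X}$ is adjacent to each vertex of $\widetilde{Y}$ if $x\sim y$ in $G$, and to none of them otherwise. *)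

theory Defs
  imports
    "Graph_Theory.Pair_Digraph"
    "Graph_Theory.Digraph_Isomorphism"
    "Jordan_Normal_Form.Char_Poly"
begin

text \<open>
  Finite simple undirected graphs are the \<^locale>\<open>pair_graph\<close>s of the library: finite,
  loop-free, with a symmetric arc relation.
\<close>

definition adjacency_matrix :: "'a list \<Rightarrow> 'a pair_pre_digraph \<Rightarrow> real mat" where
  "adjacency_matrix xs G =
     mat (length xs) (length xs) (\<lambda>(i, j). if (xs ! i, xs ! j) \<in> parcs G then 1 else 0)"

text \<open>
  The rows and columns of a matrix are indexed by natural numbers, so the vertices have to be
  enumerated first; \<open>graph_spectrum_eq\<close> below shows that the choice of the enumeration is
  immaterial. The adjacency matrix is symmetric, so all its eigenvalues are real and their
  algebraic multiplicities (those counted by \<^const>\<open>proots\<close>) agree with the geometric ones.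
\<close>

definition graph_spectrum :: "'a pair_pre_digraph \<Rightarrow> real multiset" where
  "graph_spectrum G =
     proots (char_poly (adjacency_matrix (SOME xs. distinct xs \<and> set xs = pverts G) G))"

definition regular_graph :: "'a pair_pre_digraph \<Rightarrow> bool" where
  "regular_graph G \<longleftrightarrow> (\<exists>k. \<forall>x \<in> pverts G. out_degree (with_proj G) x = k)"

definition co_edge_regular :: "'a pair_pre_digraph \<Rightarrow> bool" where
  "co_edge_regular G \<longleftrightarrow> regular_graph G \<and>
     (\<exists>\<mu>. \<forall>x \<in> pverts G. \<forall>y \<in> pverts G. x \<noteq> y \<and> (x, y) \<notin> parcs G \<longrightarrow>
        card {z \<in> pverts G. (x, z) \<in> parcs G \<and> (y, z) \<in> parcs G} = \<mu>)"

definition triangular_graph :: "nat \<Rightarrow> nat set pair_pre_digraph" where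
  "triangular_graph n =
     \<lparr> pverts = {e. e \<subseteq> {..<n} \<and> card e = 2},
       parcs = {(e, f). e \<subseteq> {..<n} \<and> card e = 2 \<and> f \<subseteq> {..<n} \<and> card f = 2 \<and>
                        card (e \<inter> f) = 1} \<rparr>"

text \<open>The vertices \<open>(x, i)\<close> with \<open>i < s\<close> form the clique that replaces \<open>x\<close>.\<close>

definition clique_extension :: "nat \<Rightarrow> 'a pair_pre_digraph \<Rightarrow> ('a \<times> nat) pair_pre_digraph" where
  "clique_extension s G =
     \<lparr> pverts = pverts G \<times> {..<s},
       parcs = {((x, i), (y, j)). x \<in> pverts G \<and> y \<in> pverts G \<and> i < s \<and> j < s \<and>
                                  (x = y \<and> i \<noteq> j \<or> (x, y) \<in> parcs G)} \<rparr>"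

lemma pair_graph_triangular_graph: "pair_graph (triangular_graph n)"
proof -
  have fin: "finite {e. e \<subseteq> {..<n} \<and> card e = 2}"
    by (rule finite_subset[of _ "Pow {..<n}"]) auto
  have "parcs (triangular_graph n) \<subseteq>
      {e. e \<subseteq> {..<n} \<and> card e = 2} \<times> {e. e \<subseteq> {..<n} \<and> card e = 2}"
    by (auto simp: triangular_graph_def)
  with fin have "finite (parcs (triangular_graph n))"
    by (meson finite_SigmaI finite_subset)
  with fin show ?thesis
    by unfold_locales
       (auto simp: triangular_graph_def symmetric_def arcs_ends_def arc_to_ends_def with_proj_def
          sym_def Int_commute)
qed

lemma pair_graph_clique_extension:
  assumes "pair_graph G"
  shows "pair_graph (clique_extension s G)"
proof -
  interpret pair_graph G by fact
  have fin: "finite (pverts G \<times> {..<s})" by (simp add: pair_finite_verts)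
  have "parcs (clique_extension s G) \<subseteq> (pverts G \<times> {..<s}) \<times> (pverts G \<times> {..<s})"
    by (auto simp: clique_extension_def)
  with fin have finp: "finite (parcs (clique_extension s G))"
    by (meson finite_SigmaI finite_subset)
  have sym: "(y, x) \<in> parcs G" if "(x, y) \<in> parcs G" for x y
    using pair_sym_arcs that by (auto simp: symmetric_def sym_def)
  have loop: "(x, x) \<notin> parcs G" for x
    using pair_no_loops[of "(x, x)"] by auto
  show ?thesis
    using fin finp sym loop
    by unfold_locales
       (auto simp: clique_extension_def symmetric_def arcs_ends_def arc_to_ends_def with_proj_def
          sym_def)
qed

lemma char_poly_adjacency_matrix_cong:
  assumes "distinct xs" "distinct ys" "set xs = set ys"
  shows "char_poly (adjacency_matrix xs G) = char_poly (adjacency_matrix ys G)"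
proof -
  define n where "n = length xs"
  have ny: "length ys = n"
    using assms by (metis distinct_card n_def)
  have nx: "length xs = n" by (simp add: n_def)
  have mem: "xs ! i \<in> set ys" "ys ! i \<in> set xs" if "i < n" for i
    using that nx ny assms(3) by (metis nth_mem)+
  define P where "P = mat n n (\<lambda>(i, j). if xs ! i = ys ! j then 1 else (0::real))"
  define Q where "Q = mat n n (\<lambda>(i, j). if ys ! i = xs ! j then 1 else (0::real))"
  have delta: "(\<Sum>k<n. (if u = zs ! k then 1 else 0) * f (zs ! k)) = f u"
    if zs: "distinct zs" "length zs = n" "u \<in> set zs" for u :: 'a and zs and f :: "'a \<Rightarrow> real"
  proof -
    obtain m where m: "m < n" "u = zs ! m" using zs by (auto simp: in_set_conv_nth)
    have "(\<Sum>k<n. (if u = zs ! k then 1 else 0) * f (zs ! k)) = (\<Sum>k<n. if k = m then f u else 0)"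
      by (rule sum.cong) (use zs m in \<open>auto simp: nth_eq_iff_index_eq\<close>)
    with m show ?thesis by simp
  qed
  have PQ: "P * Q = 1\<^sub>m n"
  proof (rule eq_matI)
    fix i j assume "i < dim_row (1\<^sub>m n :: real mat)" "j < dim_col (1\<^sub>m n :: real mat)"
    hence ij: "i < n" "j < n" by auto
    have "(P * Q) $$ (i, j) =
        (\<Sum>k<n. (if xs ! i = ys ! k then 1 else 0) * (if ys ! k = xs ! j then 1 else 0))"
      using ij by (simp add: P_def Q_def scalar_prod_def lessThan_atLeast0)
    also have "\<dots> = (if xs ! i = xs ! j then 1 else 0)"
      by (rule delta[OF assms(2) ny mem(1)[OF ij(1)], where f = "\<lambda>z. if z = xs ! j then 1 else 0"])
    finally show "(P * Q) $$ (i, j) = 1\<^sub>m n $$ (i, j)"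
      using assms(1) ij nx by (simp add: nth_eq_iff_index_eq)
  qed (auto simp: P_def Q_def)
  have QP: "Q * P = 1\<^sub>m n"
    by (rule mat_mult_left_right_inverse[OF _ _ PQ]) (auto simp: P_def Q_def)
  have "adjacency_matrix xs G * P = P * adjacency_matrix ys G"
  proof (rule eq_matI)
    fix i j assume "i < dim_row (P * adjacency_matrix ys G)" "j < dim_col (P * adjacency_matrix ys G)"
    hence ij: "i < n" "j < n" by (auto simp: P_def adjacency_matrix_def ny)
    have "(adjacency_matrix xs G * P) $$ (i, j) =
        (\<Sum>k<n. (if ys ! j = xs ! k then 1 else 0) * (if (xs ! i, xs ! k) \<in> parcs G then 1 else 0))"
      using ij by (auto simp: P_def adjacency_matrix_def scalar_prod_def lessThan_atLeast0 nx
          intro!: sum.cong)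
    also have "\<dots> = (if (xs ! i, ys ! j) \<in> parcs G then 1 else 0)"
      by (rule delta[OF assms(1) nx mem(2)[OF ij(2)],
            where f = "\<lambda>z. if (xs ! i, z) \<in> parcs G then 1 else 0"])
    also have "\<dots> =
        (\<Sum>k<n. (if xs ! i = ys ! k then 1 else 0) * (if (ys ! k, ys ! j) \<in> parcs G then 1 else 0))"
      by (rule delta[symmetric, OF assms(2) ny mem(1)[OF ij(1)],
            where f = "\<lambda>z. if (z, ys ! j) \<in> parcs G then 1 else 0"])
    also have "\<dots> = (P * adjacency_matrix ys G) $$ (i, j)"
      using ij by (simp add: P_def adjacency_matrix_def scalar_prod_def lessThan_atLeast0 ny)
    finally show "(adjacency_matrix xs G * P) $$ (i, j) = (P * adjacency_matrix ys G) $$ (i, j)" .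
  qed (auto simp: P_def adjacency_matrix_def nx ny)
  hence "adjacency_matrix xs G * P * Q = P * adjacency_matrix ys G * Q" by simp
  moreover have "adjacency_matrix xs G * P * Q = adjacency_matrix xs G"
  proof -
    have "adjacency_matrix xs G * P * Q = adjacency_matrix xs G * (P * Q)"
      by (rule assoc_mult_mat[of _ n n _ n _ n]) (auto simp: P_def Q_def adjacency_matrix_def nx)
    thus ?thesis by (simp add: PQ) (simp add: adjacency_matrix_def nx)
  qed
  ultimately have "similar_mat (adjacency_matrix xs G) (adjacency_matrix ys G)"
    using PQ QP
    by (intro similar_matI[of _ _ P Q n]) (auto simp: P_def Q_def adjacency_matrix_def nx ny)
  thus ?thesis by (rule char_poly_similar)
qed

lemma graph_spectrum_eq:
  assumes "distinct xs" "set xs = pverts G"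
  shows "graph_spectrum G = proots (char_poly (adjacency_matrix xs G))"
proof -
  have "distinct (SOME xs. distinct xs \<and> set xs = pverts G) \<and>
      set (SOME xs. distinct xs \<and> set xs = pverts G) = pverts G"
    by (rule someI[of _ xs]) (use assms in simp)
  thus ?thesis
    unfolding graph_spectrum_def
    using assms by (metis char_poly_adjacency_matrix_cong)
qed

end

theory Submission
  imports Defs "Jordan_Normal_Form.Schur_Decomposition"
begin

text \<open>
  Let \<open>B = A + I\<close>, let \<open>N x\<close> be the closed neighbourhood of \<open>x\<close>, and let \<open>a x y\<close> be the size of
  \<open>N x \<inter> N y\<close>. The spectrum gives \<open>(B - s(n - 3)) (B + s) B = 4 s\<^sup>2 (2n - 3) J\<close>. Together with
  co-edge-regularity this forces \<open>\<mu> = 4s\<close> and shows that the matrix \<open>M\<close>, which is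
  \<open>a x y - s n\<close> for \<open>y \<in> N x\<close> and \<open>0\<close> elsewhere, is \<open>s\<^sup>2 (n - 3)\<close> times the orthogonal projection
  onto the column space of \<open>B\<close>. Hence the squares in each row of \<open>M\<close> sum to \<open>s\<^sup>3 (n - 3)\<^sup>2\<close>, so
  that all but \<open>16s\<close> neighbours \<open>y\<close> of \<open>x\<close> have \<open>a x y\<close> within a quarter of \<open>s n\<close>. Among these
  there is no independent set of size three, which makes \<open>N x\<close> the union of two large cliques and
  at most \<open>20s\<close> further vertices. Large maximal cliques are therefore lines, two through each vertex.
  The row norms bound by \<open>s\<close> the number of vertices on both lines of \<open>x\<close> plus the number of
  neighbours of \<open>x\<close> on none of them. The Hoffman bound \<open>s(n - 1)\<close> for cliques and the row sums of
  \<open>M\<close>, summed over all vertices, then exclude neighbours on no common line. So there are \<open>n\<close> lines,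
  any two of them meet in \<open>s\<close> vertices, and a vertex is coordinatized by the pair of its lines.
\<close>

section \<open>Real symmetric matrices\<close>

definition mat_trace :: "'a :: comm_monoid_add mat \<Rightarrow> 'a" where
  "mat_trace A = (\<Sum>i<dim_row A. A $$ (i, i))"

lemma index_mult_mat_sum:
  assumes "A \<in> carrier_mat n m" "B \<in> carrier_mat m l" "i < n" "j < l"
  shows "(A * B) $$ (i, j) = (\<Sum>k<m. A $$ (i, k) * B $$ (k, j))"
  using assms by (auto simp: scalar_prod_def lessThan_atLeast0 intro!: sum.cong)

lemma mat_trace_comm:
  fixes A B :: "'a :: comm_semiring_0 mat"
  assumes "A \<in> carrier_mat n n" "B \<in> carrier_mat n n"
  shows "mat_trace (A * B) = mat_trace (B * A)"
proof -
  have "mat_trace (A * B) = (\<Sum>i<n. \<Sum>k<n. A $$ (i, k) * B $$ (k, i))"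
    using assms by (simp add: mat_trace_def index_mult_mat_sum[OF assms] del: index_mult_mat(1))
  also have "\<dots> = (\<Sum>k<n. \<Sum>i<n. B $$ (k, i) * A $$ (i, k))"
    by (subst sum.swap) (simp add: mult.commute)
  also have "\<dots> = mat_trace (B * A)"
    using assms by (simp add: mat_trace_def index_mult_mat_sum[OF assms(2,1)] del: index_mult_mat(1))
  finally show ?thesis .
qed

lemma mat_trace_similar:
  fixes A :: "'a :: comm_ring_1 mat"
  assumes "similar_mat_wit A B P Q"
  shows "mat_trace A = mat_trace B"
proof -
  define n where "n = dim_row A"
  note w = similar_mat_witD[OF n_def assms]
  note c = w(5,6,7)
  have "mat_trace A = mat_trace (P * (B * Q))"
    unfolding w(3) using c by (subst assoc_mult_mat[of P n n B n Q n]) simp_all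
  also have "\<dots> = mat_trace (B * Q * P)"
    using c by (intro mat_trace_comm[of _ n]) simp_all
  also have "B * Q * P = B * (Q * P)"
    using c by (intro assoc_mult_mat[of B n n Q n P n]) simp_all
  also have "\<dots> = B"
    unfolding w(2) using c by simp
  finally show ?thesis .
qed

text \<open>The same witnesses \<open>P\<close> and \<open>Q\<close> serve for both factors, so all
  polynomials in one matrix are triangularized by a single change of basis.\<close>

lemma similar_mat_wit_mult:
  fixes A :: "'a :: comm_ring_1 mat"
  assumes "similar_mat_wit A B P Q" "similar_mat_wit A' B' P Q"
  shows "similar_mat_wit (A * A') (B * B') P Q"
proof -
  define n where "n = dim_row A"
  note w = similar_mat_witD[OF n_def assms(1)]
  have n': "n = dim_row A'"
    using w(6) similar_mat_witD(6)[OF refl assms(2)] by auto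
  note w' = similar_mat_witD[OF n' assms(2)]
  note c = w(4-7) w'(4-7)
  have "A * A' = (P * B * Q) * (P * B' * Q)" by (simp only: w(3)[symmetric] w'(3)[symmetric])
  also have "\<dots> = P * B * (Q * (P * B' * Q))"
    using c by (intro assoc_mult_mat[of _ n n _ n _ n]) simp_all
  also have "Q * (P * B' * Q) = Q * (P * (B' * Q))"
    using c by (subst assoc_mult_mat[of P n n _ n _ n]) simp_all
  also have "\<dots> = Q * P * (B' * Q)"
    using c by (intro assoc_mult_mat[symmetric, of _ n n _ n _ n]) simp_all
  also have "\<dots> = B' * Q" unfolding w(2) using c by simp
  also have "P * B * (B' * Q) = P * B * B' * Q"
    using c by (intro assoc_mult_mat[symmetric, of _ n n _ n _ n]) simp_all
  also have "P * B * B' = P * (B * B')"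
    using c by (intro assoc_mult_mat[of _ n n _ n _ n]) simp_all
  finally show ?thesis
    using c w(1,2) by (intro similar_mat_witI[of _ _ n]) (simp_all add: mult_carrier_mat[of _ n n])
qed

lemma similar_mat_wit_add_smult_one:
  fixes A :: "'a :: comm_ring_1 mat"
  assumes "similar_mat_wit A B P Q" "A \<in> carrier_mat n n"
  shows "similar_mat_wit (A + c \<cdot>\<^sub>m 1\<^sub>m n) (B + c \<cdot>\<^sub>m 1\<^sub>m n) P Q"
proof -
  have n: "n = dim_row A" using assms by auto
  note w = similar_mat_witD[OF n assms(1)]
  have one: "c \<cdot>\<^sub>m 1\<^sub>m n \<in> carrier_mat n n" by (rule smult_carrier_mat) (rule one_carrier_mat)
  note c = w(4-7) one
  have "P * (B + c \<cdot>\<^sub>m 1\<^sub>m n) = P * B + P * (c \<cdot>\<^sub>m 1\<^sub>m n)"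
    using c by (intro mult_add_distrib_mat[of P n n _ n]) (simp_all add: smult_carrier_mat)
  also have "P * (c \<cdot>\<^sub>m 1\<^sub>m n) = c \<cdot>\<^sub>m P"
    using c by (subst mult_smult_distrib[of P n n _ n]) (simp_all add: smult_carrier_mat)
  finally have "P * (B + c \<cdot>\<^sub>m 1\<^sub>m n) * Q = (P * B + c \<cdot>\<^sub>m P) * Q" by simp
  also have "\<dots> = P * B * Q + (c \<cdot>\<^sub>m P) * Q"
    using c by (intro add_mult_distrib_mat[of _ n n]) (simp_all add: smult_carrier_mat mult_carrier_mat[of _ n n])
  also have "(c \<cdot>\<^sub>m P) * Q = c \<cdot>\<^sub>m (P * Q)"
    using c by (intro mult_smult_assoc_mat[of P n n Q n]) simp_all
  finally show ?thesis
    using c unfolding w(1) w(3)[symmetric]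
    by (intro similar_mat_witI[of _ _ n]) (simp_all add: w(1,2) smult_carrier_mat)
qed

text \<open>Every off-diagonal product in the relevant sums has a factor below a diagonal. That
  diagonals multiply entrywise gives the eigenvalues of polynomials in a triangular matrix.\<close>

lemma upper_triangular_mult:
  fixes A :: "'a :: semiring_0 mat"
  assumes A: "A \<in> carrier_mat n n" "upper_triangular A"
    and B: "B \<in> carrier_mat n n" "upper_triangular B"
  shows "upper_triangular (A * B)"
    and "i < n \<Longrightarrow> (A * B) $$ (i, i) = A $$ (i, i) * B $$ (i, i)"
proof -
  have z: "A $$ (i, k) * B $$ (k, j) = 0" if "i < n" "k < n" "j \<le> i" "j < i \<or> k \<noteq> i" for i j k
  proof (cases "k < i")
    case True thus ?thesis using A that by (simp add: upper_triangularD[of A])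
  next
    case False
    hence "j < k" using that by auto
    thus ?thesis using B that by (simp add: upper_triangularD[of B])
  qed
  show "upper_triangular (A * B)"
  proof
    fix i j assume "j < i" "i < dim_row (A * B)"
    hence ij: "j < i" "i < n" "j < n" using A by auto
    show "(A * B) $$ (i, j) = 0"
      unfolding index_mult_mat_sum[OF A(1) B(1) ij(2,3)]
      using ij by (intro sum.neutral ballI z) auto
  qed
  assume i: "i < n"
  have "(A * B) $$ (i, i) = (\<Sum>k<n. if k = i then A $$ (i, i) * B $$ (i, i) else 0)"
    unfolding index_mult_mat_sum[OF A(1) B(1) i i]
    using i by (intro sum.cong) (auto intro: z)
  thus "(A * B) $$ (i, i) = A $$ (i, i) * B $$ (i, i)" using i by simp
qed

lemma mat_trace_square_symmetric:
  fixes A :: "'a :: comm_semiring_1 mat"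
  assumes "A \<in> carrier_mat n n" "\<And>i j. i < n \<Longrightarrow> j < n \<Longrightarrow> A $$ (j, i) = A $$ (i, j)"
  shows "mat_trace (A * A) = (\<Sum>i<n. \<Sum>j<n. (A $$ (i, j))\<^sup>2)"
  using assms
  by (simp add: mat_trace_def index_mult_mat_sum[OF assms(1,1)] power2_eq_square del: index_mult_mat(1))

section \<open>Splitting of real symmetric characteristic polynomials\<close>

lemma symmetric_real_eigenvalue_real:
  fixes A :: "real mat"
  assumes A: "A \<in> carrier_mat n n" and sym: "\<And>i j. i < n \<Longrightarrow> j < n \<Longrightarrow> A $$ (j, i) = A $$ (i, j)"
    and ev: "eigenvalue (map_mat complex_of_real A) e"
  shows "e \<in> \<real>"
proof -
  obtain v where v: "v \<in> carrier_vec n" "v \<noteq> 0\<^sub>v n"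
    and eq: "map_mat complex_of_real A *\<^sub>v v = e \<cdot>\<^sub>v v"
    using ev A by (auto simp: eigenvalue_def eigenvector_def)
  have row: "(\<Sum>j<n. of_real (A $$ (i, j)) * v $ j) = e * v $ i" if "i < n" for i
  proof -
    have "(map_mat complex_of_real A *\<^sub>v v) $ i = (e \<cdot>\<^sub>v v) $ i" by (simp add: eq)
    thus ?thesis using that A v by (simp add: scalar_prod_def lessThan_atLeast0)
  qed
  \<comment> \<open>\<open>S\<close> is the Hermitian form of \<open>A\<close> at \<open>v\<close>.
    It equals \<open>e\<close> times the squared norm \<open>r\<close> and, by symmetry of
    \<open>A\<close>, its own conjugate; dividing by \<open>r\<close> shows that \<open>e\<close> is
    real.\<close>
  define S where "S = (\<Sum>i<n. \<Sum>j<n. cnj (v $ i) * of_real (A $$ (i, j)) * v $ j)"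
  define r where "r = (\<Sum>i<n. (cmod (v $ i))\<^sup>2)"
  have "S = (\<Sum>i<n. cnj (v $ i) * (e * v $ i))"
    unfolding S_def by (intro sum.cong refl) (simp add: row[symmetric] sum_distrib_left mult.assoc)
  also have "\<dots> = e * of_real r"
    by (simp add: r_def sum_distrib_left complex_norm_square mult_ac del: of_real_power)
  finally have S: "S = e * of_real r" .
  have "cnj S = (\<Sum>i<n. \<Sum>j<n. v $ i * of_real (A $$ (i, j)) * cnj (v $ j))"
    by (simp add: S_def)
  also have "\<dots> = (\<Sum>j<n. \<Sum>i<n. v $ i * of_real (A $$ (i, j)) * cnj (v $ j))"
    by (rule sum.swap)
  also have "\<dots> = S"
    unfolding S_def using sym by (intro sum.cong refl) (auto simp: mult_ac)
  finally have "cnj S = S" .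
  hence "cnj e * of_real r = e * of_real r" by (simp add: S)
  moreover have "r \<noteq> 0"
  proof
    assume "r = 0"
    hence "\<forall>i\<in>{..<n}. (cmod (v $ i))\<^sup>2 = 0"
      unfolding r_def by (subst (asm) sum_nonneg_eq_0_iff) auto
    hence "v = 0\<^sub>v n" using v by (intro eq_vecI) auto
    thus False using v by simp
  qed
  ultimately have "cnj e = e" by simp
  thus ?thesis by (simp add: Reals_cnj_iff)
qed

text \<open>The polynomial factors over the complex numbers, its roots are real eigenvalues, and the
  factorization descends because the embedding of real polynomials into complex ones is
  injective.\<close>

lemma symmetric_real_char_poly_splits:
  fixes A :: "real mat"
  assumes A: "A \<in> carrier_mat n n" and sym: "\<And>i j. i < n \<Longrightarrow> j < n \<Longrightarrow> A $$ (j, i) = A $$ (i, j)"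
  obtains es where "char_poly A = (\<Prod>e\<leftarrow>es. [:- e, 1:])" "length es = n"
proof -
  let ?A = "map_mat complex_of_real A"
  have cA: "?A \<in> carrier_mat n n" using A by simp
  obtain as where as: "char_poly ?A = (\<Prod>a\<leftarrow>as. [:- a, 1:])" "length as = n"
    using char_poly_factorized[OF cA] by blast
  have re: "of_real (Re a) = a" if "a \<in> set as" for a
  proof -
    have "poly (char_poly ?A) a = 0"
      unfolding as(1) poly_prod_list using that by (auto simp: prod_list_zero_iff)
    hence "a \<in> \<real>"
      using symmetric_real_eigenvalue_real[OF A sym] eigenvalue_root_char_poly[OF cA] by blast
    thus ?thesis by (simp add: of_real_Re)
  qed
  interpret of_real_poly: map_poly_inj_idom_hom complex_of_real ..
  have hom: "map_poly complex_of_real (\<Prod>e\<leftarrow>es. [:- e, 1:]) = (\<Prod>e\<leftarrow>es. [:- of_real e, 1:])" for es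
    proof (induction es)
    case (Cons e es)
    show ?case using Cons by (simp add: of_real_poly.hom_mult del: mult_pCons_left)
  qed simp
  have "map_poly complex_of_real (char_poly A) = (\<Prod>a\<leftarrow>as. [:- a, 1:])"
    using of_real_hom.char_poly_hom[OF A] as by metis
  also have "\<dots> = (\<Prod>e\<leftarrow>map Re as. [:- complex_of_real e, 1:])"
    using re by (auto intro!: arg_cong[of _ _ prod_list] simp: o_def)
  also have "\<dots> = map_poly complex_of_real (\<Prod>e\<leftarrow>map Re as. [:- e, 1:])"
    by (rule hom[symmetric])
  finally have "char_poly A = (\<Prod>e\<leftarrow>map Re as. [:- e, 1:])"
    by (rule of_real_poly.injectivity)
  thus ?thesis by (rule that) (simp add: as)
qed

lemma proots_linear_factors:
  "proots (\<Prod>e\<leftarrow>es. [:- e, 1:]) = mset (es :: 'a :: idom list)"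
proof (induction es)
  case (Cons e es)
  have "(\<Prod>e\<leftarrow>es. [:- e, 1:]) \<noteq> 0" by (auto simp: prod_list_zero_iff)
  thus ?case using Cons by (simp add: proots_mult del: mult_pCons_left)
qed simp

text \<open>Schur triangularization stands in for the spectral theorem: the diagonal of
  \<open>U\<close> carries the eigenvalues with multiplicity, and only traces are read off it
  later.\<close>

lemma symmetric_real_triangularizable:
  fixes A :: "real mat"
  assumes A: "A \<in> carrier_mat n n" and sym: "\<And>i j. i < n \<Longrightarrow> j < n \<Longrightarrow> A $$ (j, i) = A $$ (i, j)"
  obtains U P Q where "similar_mat_wit A U P Q" "upper_triangular U"
    "mset (diag_mat U) = proots (char_poly A)"
proof -
  obtain es where es: "char_poly A = (\<Prod>e\<leftarrow>es. [:- e, 1:])"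
    using symmetric_real_char_poly_splits[OF A sym] by blast
  obtain U P Q where "schur_decomposition A es = (U, P, Q)"
    by (metis prod_cases3)
  from schur_decomposition[OF A es this] show ?thesis
    by (intro that[of U P Q]) (simp_all add: es proots_linear_factors)
qed

text \<open>The Frobenius norm of \<open>A - (r/n) J\<close> is computed from the trace of the square of \<open>A\<close>.\<close>

lemma constant_symmetric_matrix:
  fixes A :: "real mat"
  assumes A: "A \<in> carrier_mat n n" and sym: "\<And>i j. i < n \<Longrightarrow> j < n \<Longrightarrow> A $$ (j, i) = A $$ (i, j)"
    and row: "\<And>i. i < n \<Longrightarrow> (\<Sum>j<n. A $$ (i, j)) = r"
    and tr: "mat_trace (A * A) = r\<^sup>2"
    and ij: "i < n" "j < n"
  shows "A $$ (i, j) = r / n"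
proof -
  define c where "c = r / n"
  have cn: "c * n = r" using ij by (simp add: c_def)
  have "(\<Sum>i<n. \<Sum>j<n. (A $$ (i, j) - c)\<^sup>2)
      = (\<Sum>i<n. \<Sum>j<n. (A $$ (i, j))\<^sup>2 - 2 * c * A $$ (i, j) + c\<^sup>2)"
    by (simp add: power2_diff algebra_simps)
  also have "\<dots> = (\<Sum>i<n. \<Sum>j<n. (A $$ (i, j))\<^sup>2) - 2 * c * (\<Sum>i<n. \<Sum>j<n. A $$ (i, j)) + n * n * c\<^sup>2"
    by (simp add: sum.distrib sum_subtractf sum_distrib_left algebra_simps)
  also have "\<dots> = r\<^sup>2 - 2 * (c * n) * r + (c * n)\<^sup>2"
    using row tr mat_trace_square_symmetric[OF A sym] by (simp add: power_mult_distrib power2_eq_square[of n] power2_eq_square[of "real n"] mult_ac)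
  also have "\<dots> = 0" by (simp add: cn power2_eq_square)
  finally have "(\<Sum>i<n. \<Sum>j<n. (A $$ (i, j) - c)\<^sup>2) = 0" .
  hence "\<forall>i\<in>{..<n}. (\<Sum>j<n. (A $$ (i, j) - c)\<^sup>2) = 0"
    by (subst (asm) sum_nonneg_eq_0_iff) (auto intro: sum_nonneg)
  hence "\<forall>j\<in>{..<n}. (A $$ (i, j) - c)\<^sup>2 = 0"
    using ij by (subst (asm) sum_nonneg_eq_0_iff) auto
  thus ?thesis using ij by (simp add: c_def)
qed

lemma sum_diag_mat:
  assumes "U \<in> carrier_mat n n"
  shows "(\<Sum>i<n. f (U $$ (i, i))) = (\<Sum>x\<in>#mset (diag_mat U). f x)"
  using assms by (simp add: diag_mat_def sum_mset_sum_list interv_sum_list_conv_sum_set_nat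
      lessThan_atLeast0 o_def del: mset_map flip: mset_map)

text \<open>Here \<open>C\<close> stands for \<open>A + I\<close>, whose eigenvalues are \<open>K\<close>, \<open>t\<close>, \<open>-s\<close> and \<open>0\<close>; the simple
  eigenvalue \<open>K\<close> has the all-ones eigenvector, so \<open>(C - t)(C + s)C\<close> is a multiple of \<open>J\<close>.\<close>

lemma symmetric_cubic_identity:
  fixes C :: "real mat" and s t K :: real
  assumes C: "C \<in> carrier_mat N N" and sym: "\<And>i j. i < N \<Longrightarrow> j < N \<Longrightarrow> C $$ (j, i) = C $$ (i, j)"
    and row: "\<And>i. i < N \<Longrightarrow> (\<Sum>j<N. C $$ (i, j)) = K"
    and U: "similar_mat_wit C U P Q" "upper_triangular U"
    and spec: "mset (diag_mat U) = replicate_mset 1 K + replicate_mset a t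
                 + replicate_mset b (- s) + replicate_mset c 0"
    and ij: "i < N" "j < N"
  shows "(\<Sum>k<N. C $$ (i, k) * (\<Sum>l<N. C $$ (k, l) * C $$ (l, j)))
       = (t - s) * (\<Sum>l<N. C $$ (i, l) * C $$ (l, j)) + t * s * C $$ (i, j)
         + (K - t) * (K + s) * K / N"
proof -
  define I where "I = (1\<^sub>m N :: real mat)"
  define X where "X = C + (- t) \<cdot>\<^sub>m I"
  define Y where "Y = C + s \<cdot>\<^sub>m I"
  define F where "F = X * (Y * C)"
  define XU where "XU = U + (- t) \<cdot>\<^sub>m I"
  define YU where "YU = U + s \<cdot>\<^sub>m I"
  define FU where "FU = XU * (YU * U)"
  have N: "N = dim_row C" using C by simp
  have cU: "U \<in> carrier_mat N N" using similar_mat_witD[OF N U(1)] by simp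
  have cI: "I \<in> carrier_mat N N" by (simp add: I_def)
  have cs: "X \<in> carrier_mat N N" "Y \<in> carrier_mat N N" "XU \<in> carrier_mat N N" "YU \<in> carrier_mat N N"
    using C cU cI by (simp_all add: X_def Y_def XU_def YU_def)
  have cp: "Y * C \<in> carrier_mat N N" "F \<in> carrier_mat N N" "YU * U \<in> carrier_mat N N"
    "FU \<in> carrier_mat N N"
    using cs C cU by (simp_all add: F_def FU_def)
  have simF: "similar_mat_wit F FU P Q"
    unfolding F_def FU_def X_def Y_def XU_def YU_def I_def
    by (intro similar_mat_wit_mult similar_mat_wit_add_smult_one U C)
  have ut: "upper_triangular XU" "upper_triangular YU"
    using U(2) cU by (auto simp: XU_def YU_def I_def upper_triangular_def)
  note ut2 = upper_triangular_mult[OF cs(4) ut(2) cU U(2)]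
  note ut3 = upper_triangular_mult[OF cs(3) ut(1) cp(3) ut2(1), folded FU_def]
  have diag: "FU $$ (i, i) = (U $$ (i, i) - t) * ((U $$ (i, i) + s) * U $$ (i, i))" if "i < N" for i
    using that cU by (simp add: ut3(2) ut2(2)) (simp add: XU_def YU_def I_def)
  have diag2: "(FU * FU) $$ (i, i) = (FU $$ (i, i))\<^sup>2" if "i < N" for i
    using upper_triangular_mult(2)[OF cp(4) ut3(1) cp(4) ut3(1) that] by (simp add: power2_eq_square)
  \<comment> \<open>The polynomial (u - t)(u + s)u vanishes at \<open>t\<close>, \<open>- s\<close>
    and \<open>0\<close>, so only the single diagonal entry \<open>K\<close> contributes. The trace
    of the square of \<open>F\<close> is thus the square of its row sum, which forces
    \<open>F\<close> to be constant.\<close>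
  have "mat_trace (F * F) = mat_trace (FU * FU)"
    by (rule mat_trace_similar[OF similar_mat_wit_mult[OF simF simF]])
  also have "\<dots> = (\<Sum>i<N. (\<lambda>u. ((u - t) * ((u + s) * u))\<^sup>2) (U $$ (i, i)))"
    using cp(4) by (simp add: mat_trace_def diag2 diag del: index_mult_mat(1))
  also have "\<dots> = ((K - t) * (K + s) * K)\<^sup>2"
    unfolding sum_diag_mat[OF cU, of "\<lambda>u. ((u - t) * ((u + s) * u))\<^sup>2"] spec
    by (simp add: power_mult_distrib mult_ac)
  finally have tr: "mat_trace (F * F) = ((K - t) * (K + s) * K)\<^sup>2" .
  define D where "D i j = (\<Sum>l<N. C $$ (i, l) * C $$ (l, j))" for i j
  define T where "T i j = (\<Sum>k<N. C $$ (i, k) * D k j)" for i j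
  have YC: "(Y * C) $$ (i, j) = D i j + s * C $$ (i, j)" if "i < N" "j < N" for i j
  proof -
    have "(Y * C) $$ (i, j) = (\<Sum>k<N. (C $$ (i, k) + s * (if i = k then 1 else 0)) * C $$ (k, j))"
      unfolding index_mult_mat_sum[OF cs(2) C that]
      using that C by (intro sum.cong refl) (auto simp: Y_def I_def)
    thus ?thesis
      using that by (simp add: D_def distrib_right sum.distrib if_distrib[of "\<lambda>x. s * x * _"] cong: if_cong)
  qed
  have Fij: "F $$ (i, j) = T i j + s * D i j - t * (D i j + s * C $$ (i, j))"
    if "i < N" "j < N" for i j
  proof -
    have "F $$ (i, j) = (\<Sum>k<N. (C $$ (i, k) - t * (if i = k then 1 else 0)) * (D k j + s * C $$ (k, j)))"
      unfolding F_def index_mult_mat_sum[OF cs(1) cp(1) that]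
      using that C by (intro sum.cong refl) (auto simp: YC, auto simp: X_def I_def)
    also have "\<dots> = (\<Sum>k<N. C $$ (i, k) * D k j + s * (C $$ (i, k) * C $$ (k, j))
        - (if i = k then t * (D k j + s * C $$ (k, j)) else 0))"
      by (intro sum.cong refl) (simp add: algebra_simps)
    also have "\<dots> = T i j + s * D i j - t * (D i j + s * C $$ (i, j))"
      using that by (simp add: sum_subtractf sum.distrib sum_distrib_left T_def D_def)
    finally show ?thesis .
  qed
  have Dsym: "D j i = D i j" if "i < N" "j < N" for i j
    unfolding D_def using that sym by (intro sum.cong refl) (auto simp: mult.commute)
  have Tsym: "T j i = T i j" if "i < N" "j < N" for i j
  proof -
    have "T j i = (\<Sum>k<N. \<Sum>l<N. C $$ (j, k) * (C $$ (k, l) * C $$ (l, i)))"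
      by (simp add: T_def D_def sum_distrib_left)
    also have "\<dots> = (\<Sum>l<N. \<Sum>k<N. C $$ (j, k) * (C $$ (k, l) * C $$ (l, i)))"
      by (rule sum.swap)
    also have "\<dots> = T i j"
      unfolding T_def D_def sum_distrib_left
      using that sym by (intro sum.cong refl) (auto simp: mult_ac)
    finally show ?thesis .
  qed
  have Drow: "(\<Sum>j<N. D i j) = K * K" if "i < N" for i
    unfolding D_def using that
    by (subst sum.swap) (simp add: sum_distrib_left[symmetric] row sum_distrib_right[symmetric])
  have Trow: "(\<Sum>j<N. T i j) = K * K * K" if "i < N" for i
    unfolding T_def using that
    by (subst sum.swap) (simp add: sum_distrib_left[symmetric] row Drow sum_distrib_right[symmetric])
  have "F $$ (i, j) = (K - t) * (K + s) * K / N"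
  proof (rule constant_symmetric_matrix[OF cp(2) _ _ tr ij])
    fix i j assume "i < N" "j < N"
    thus "F $$ (j, i) = F $$ (i, j)" by (simp add: Fij Dsym Tsym sym)
  next
    fix i assume i: "i < N"
    hence "(\<Sum>j<N. F $$ (i, j)) = K * K * K + s * (K * K) - t * (K * K + s * K)"
      by (simp add: Fij sum_subtractf sum.distrib sum_distrib_left[symmetric] Trow Drow row)
    thus "(\<Sum>j<N. F $$ (i, j)) = (K - t) * (K + s) * K" by (simp add: algebra_simps)
  qed
  thus ?thesis
    using Fij[OF ij] by (simp add: T_def D_def algebra_simps)
qed

section \<open>Counting with the closed neighbourhoods\<close>

lemma card_Int_sum: "finite A \<Longrightarrow> real (card (A \<inter> B)) = (\<Sum>w\<in>A. of_bool (w \<in> B))"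
  by (simp add: sum.If_cases of_bool_def)

text \<open>The sets \<open>N x\<close> are closed neighbourhoods, that is, the rows of B = A + I.
  Assumption \<open>walk3\<close> is the entry (x, y) of B^3 = s(n - 4) B^2 + s^2 (n - 3) B + 4 s^2
  (2n - 3) J.\<close>

locale triangular_spectrum =
  fixes V :: "'a set" and N :: "'a \<Rightarrow> 'a set" and s n \<mu> :: nat
  assumes fin: "finite V"
    and ne: "V \<noteq> {}"
    and N_sub: "x \<in> V \<Longrightarrow> N x \<subseteq> V"
    and N_refl: "x \<in> V \<Longrightarrow> x \<in> N x"
    and N_sym: "x \<in> V \<Longrightarrow> y \<in> N x \<Longrightarrow> x \<in> N y"
    and s2: "s \<ge> 2" and n48: "n \<ge> 48 * s"
    and card_V: "real (card V) = s * n * (real n - 1) / 2"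
    and card_N: "x \<in> V \<Longrightarrow> real (card (N x)) = s * (2 * real n - 3)"
    and coedge: "x \<in> V \<Longrightarrow> y \<in> V \<Longrightarrow> y \<notin> N x \<Longrightarrow> card (N x \<inter> N y) = \<mu>"
    and walk3: "x \<in> V \<Longrightarrow> y \<in> V \<Longrightarrow> (\<Sum>z\<in>N x. real (card (N z \<inter> N y))) =
       s * (real n - 4) * real (card (N x \<inter> N y)) + s\<^sup>2 * (real n - 3) * of_bool (y \<in> N x)
       + 4 * s\<^sup>2 * (2 * real n - 3)"
begin

lemma n96: "real n \<ge> 96" "real n \<ge> 48 * real s" "real s \<ge> 2"
  using s2 n48 by linarith+

lemma N_sym_iff: "x \<in> V \<Longrightarrow> y \<in> V \<Longrightarrow> y \<in> N x \<longleftrightarrow> x \<in> N y"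
  using N_sym by blast

lemma of_bool_N_sym: "x \<in> V \<Longrightarrow> y \<in> V \<Longrightarrow> of_bool (y \<in> N x) = (of_bool (x \<in> N y) :: real)"
  by (simp add: N_sym_iff)

lemma N_in: "x \<in> V \<Longrightarrow> y \<in> N x \<Longrightarrow> y \<in> V"
  using N_sub by blast

lemma fin_N: "x \<in> V \<Longrightarrow> finite (N x)"
  using finite_subset[OF N_sub fin] .

definition a :: "'a \<Rightarrow> 'a \<Rightarrow> real" where "a x y = real (card (N x \<inter> N y))"

lemma a_sym: "a x y = a y x"
  by (simp add: a_def Int_commute)

lemma sum_N_swap:
  assumes "x \<in> V"
  shows "(\<Sum>z\<in>V. of_bool (z \<in> N x) * f z) = (\<Sum>z\<in>N x. (f z :: real))"
proof -
  have "(\<Sum>z\<in>N x. f z) = (\<Sum>z\<in>V. if z \<in> N x then f z else 0)"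
    using N_sub[OF assms] fin by (intro sum.mono_neutral_cong_left) auto
  also have "\<dots> = (\<Sum>z\<in>V. of_bool (z \<in> N x) * f z)" by (intro sum.cong) auto
  finally show ?thesis by simp
qed

lemma a_sum: "x \<in> V \<Longrightarrow> a x y = (\<Sum>w\<in>N x. of_bool (w \<in> N y))"
  unfolding a_def by (rule card_Int_sum[OF fin_N])

lemma sum_a:
  assumes "x \<in> V"
  shows "(\<Sum>z\<in>V. a x z) = (s * (2 * real n - 3))\<^sup>2"
proof -
  have "(\<Sum>z\<in>V. a x z) = (\<Sum>w\<in>N x. \<Sum>z\<in>V. of_bool (w \<in> N z))"
    unfolding a_sum[OF assms] by (rule sum.swap)
  also have "\<dots> = (\<Sum>w\<in>N x. \<Sum>z\<in>V. of_bool (z \<in> N w) * 1)"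
    using N_in[OF assms] by (intro sum.cong refl) (simp only: of_bool_N_sym mult_1_right)
  also have "\<dots> = (\<Sum>w\<in>N x. real (card (N w)))"
    using N_in[OF assms] by (intro sum.cong refl) (simp only: sum_N_swap, simp)
  also have "\<dots> = (s * (2 * real n - 3))\<^sup>2"
    using N_in[OF assms] by (simp add: card_N assms power2_eq_square)
  finally show ?thesis .
qed

text \<open>Row \<open>x\<close> of B^2 sums to K^2 with K = s(2n - 3). The share of
  \<open>N x\<close> is a diagonal entry of B^3, known from \<open>walk3\<close> with y = x; each of
  the s(n - 2)(n - 3)/2 other vertices contributes \<open>\<mu>\<close>.\<close>

lemma mu: "\<mu> = 4 * s"
proof -
  obtain x where x: "x \<in> V" using ne by blast
  have "(\<Sum>z\<in>V. a x z) = (\<Sum>z\<in>N x. a x z) + (\<Sum>z\<in>V - N x. a x z)"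
    using sum.subset_diff[OF N_sub[OF x] fin, of "a x"] by simp
  also have "(\<Sum>z\<in>V - N x. a x z) = real (card (V - N x)) * real \<mu>"
    using coedge[OF x] by (simp add: a_def)
  also have "real (card (V - N x)) = real (card V) - real (card (N x))"
    using N_sub[OF x] fin_N[OF x] fin card_mono[OF fin N_sub[OF x]] by (simp add: card_Diff_subset)
  also have "(\<Sum>z\<in>N x. a x z) = s * (real n - 4) * (s * (2 * real n - 3)) + s\<^sup>2 * (real n - 3)
       + 4 * s\<^sup>2 * (2 * real n - 3)"
    using walk3[OF x x] x by (simp add: a_def Int_commute card_N N_refl)
  finally have "(s * n * (real n - 1) / 2 - s * (2 * real n - 3)) * real \<mu> =
     (s * (2 * real n - 3))\<^sup>2 - (s * (real n - 4) * (s * (2 * real n - 3)) + s\<^sup>2 * (real n - 3)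
       + 4 * s\<^sup>2 * (2 * real n - 3))"
    using sum_a[OF x] by (simp add: card_V card_N x)
  moreover have "s * n * (real n - 1) / 2 - s * (2 * real n - 3) = s * (real n - 2) * (real n - 3) / 2"
    by (simp add: field_simps)
  moreover have "(s * (2 * real n - 3))\<^sup>2 - (s * (real n - 4) * (s * (2 * real n - 3))
      + s\<^sup>2 * (real n - 3) + 4 * s\<^sup>2 * (2 * real n - 3)) = s * (real n - 2) * (real n - 3) / 2 * (4 * s)"
    by (simp add: field_simps power2_eq_square)
  ultimately have "s * (real n - 2) * (real n - 3) / 2 * \<mu> = s * (real n - 2) * (real n - 3) / 2 * (4 * s)"
    by (simp only:)
  hence "real \<mu> = 4 * s" using n96 by simp
  thus ?thesis by linarith
qed

lemma a_nonadj: "x \<in> V \<Longrightarrow> y \<in> V \<Longrightarrow> y \<notin> N x \<Longrightarrow> a x y = 4 * s"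
  using coedge mu by (simp add: a_def)

section \<open>The matrix \<open>M\<close>, a multiple of a projection\<close>

definition M :: "'a \<Rightarrow> 'a \<Rightarrow> real" where
  "M x y = (if y \<in> N x then a x y - real s * n else 0)"

abbreviation \<kappa> :: real where "\<kappa> \<equiv> (real s)\<^sup>2 * (real n - 3)"

lemma M_sym: "x \<in> V \<Longrightarrow> y \<in> V \<Longrightarrow> M x y = M y x"
  by (simp add: M_def N_sym_iff[of x y] a_sym[of x y])

text \<open>Globally \<open>M\<close> is B^2 - s(n - 4) B - 4s J, so the algebra of B applies to it;
  the value 4s of \<open>\<mu>\<close> is what makes the entries at nonadjacent pairs
  vanish.\<close>

lemma M_eq: "x \<in> V \<Longrightarrow> y \<in> V \<Longrightarrow> M x y = a x y - real s * (real n - 4) * of_bool (y \<in> N x) - 4 * s"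
  by (auto simp: M_def a_nonadj algebra_simps)

text \<open>This is BM = \<open>\<kappa>\<close> B. The multiple of J in \<open>walk3\<close>
  cancels against 4s times the row sum of B.\<close>

lemma sum_M:
  assumes "x \<in> V" "y \<in> V"
  shows "(\<Sum>z\<in>N x. M z y) = \<kappa> * of_bool (y \<in> N x)"
proof -
  have "(\<Sum>z\<in>N x. M z y) = (\<Sum>z\<in>N x. a z y) - real s * (real n - 4) * (\<Sum>z\<in>N x. of_bool (y \<in> N z)) - 4 * s * card (N x)"
    using N_in[OF assms(1)] assms(2) by (simp add: M_eq sum_subtractf sum_distrib_left cong: sum.cong)
  also have "(\<Sum>z\<in>N x. of_bool (y \<in> N z)) = (\<Sum>z\<in>N x. of_bool (z \<in> N y) :: real)"
    using N_in[OF assms(1)] assms(2) by (intro sum.cong refl) (simp add: of_bool_N_sym)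
  also have "\<dots> = a x y" using assms by (simp add: a_sum)
  finally show ?thesis
    using walk3[OF assms] assms by (simp add: a_def card_N power2_eq_square algebra_simps)
qed

lemma sum_M_row:
  assumes "x \<in> V"
  shows "(\<Sum>z\<in>N x. M x z) = \<kappa>"
proof -
  have "(\<Sum>z\<in>N x. M x z) = (\<Sum>z\<in>N x. M z x)"
    using N_in[OF assms] M_sym[OF assms] by (intro sum.cong refl) auto
  thus ?thesis using sum_M[OF assms assms] N_refl[OF assms] by simp
qed

text \<open>This is M^2 = \<open>\<kappa>\<close> M: expand the right factor by \<open>M_eq\<close>,
  then use MB = \<open>\<kappa>\<close> B and the row sum \<open>\<kappa>\<close> of
  \<open>M\<close>.\<close>

lemma M_square:
  assumes x: "x \<in> V" and y: "y \<in> V"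
  shows "(\<Sum>z\<in>V. M x z * M z y) = \<kappa> * M x y"
proof -
  have N: "(\<Sum>z\<in>V. M x z * of_bool (z \<in> N w)) = \<kappa> * of_bool (x \<in> N w)" if "w \<in> V" for w
  proof -
    have "(\<Sum>z\<in>V. M x z * of_bool (z \<in> N w)) = (\<Sum>z\<in>V. of_bool (z \<in> N w) * M z x)"
      using x by (intro sum.cong refl) (simp add: M_sym)
    thus ?thesis using that x by (simp add: sum_N_swap sum_M)
  qed
  have "(\<Sum>z\<in>V. M x z * M z y) = (\<Sum>z\<in>V. M x z * a y z
      - real s * (real n - 4) * (M x z * of_bool (z \<in> N y)) - 4 * s * M x z)"
    using y by (intro sum.cong refl)
      (simp add: M_eq[of _ y] a_sym[of y] of_bool_N_sym[of _ y] right_diff_distrib mult_ac)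
  also have "\<dots> = (\<Sum>z\<in>V. M x z * a y z)
      - real s * (real n - 4) * (\<Sum>z\<in>V. M x z * of_bool (z \<in> N y)) - 4 * s * (\<Sum>z\<in>V. M x z)"
    by (simp only: sum_subtractf sum_distrib_left)
  also have "(\<Sum>z\<in>V. M x z * a y z) = (\<Sum>z\<in>V. \<Sum>w\<in>N y. M x z * of_bool (z \<in> N w))"
    unfolding a_sum[OF y] sum_distrib_left using N_in[OF y]
    by (intro sum.cong refl) (simp add: of_bool_N_sym)
  also have "\<dots> = (\<Sum>w\<in>N y. \<Sum>z\<in>V. M x z * of_bool (z \<in> N w))" by (rule sum.swap)
  also have "\<dots> = (\<Sum>w\<in>N y. \<kappa> * of_bool (x \<in> N w))"
    using N_in[OF y] N by (intro sum.cong) auto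
  also have "\<dots> = \<kappa> * (\<Sum>w\<in>N y. of_bool (w \<in> N x))"
    unfolding sum_distrib_left using N_in[OF y] x by (intro sum.cong refl) (simp add: of_bool_N_sym)
  also have "\<dots> = \<kappa> * a x y" using y by (simp add: a_sum a_sym[of x])
  also have "(\<Sum>z\<in>V. M x z) = (\<Sum>z\<in>N x. M x z)"
    using N_sub[OF x] fin by (intro sum.mono_neutral_right) (auto simp: M_def)
  also have "\<dots> = \<kappa>" by (rule sum_M_row[OF x])
  finally show ?thesis
    unfolding N[OF y] M_eq[OF x y] N_sym_iff[OF x y] by (simp add: algebra_simps)
qed

lemma M_self: "x \<in> V \<Longrightarrow> M x x = s * (real n - 3)"
  by (simp add: M_def N_refl a_def card_N algebra_simps)

text \<open>By symmetry the sum is a diagonal entry of M^2 = \<open>\<kappa>\<close> M.\<close>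

lemma M_norm:
  assumes "x \<in> V"
  shows "(\<Sum>z\<in>N x. (M x z)\<^sup>2) = real s ^ 3 * (real n - 3)\<^sup>2"
proof -
  have "(\<Sum>z\<in>N x. (M x z)\<^sup>2) = (\<Sum>z\<in>V. (M x z)\<^sup>2)"
    using N_sub[OF assms] fin by (intro sum.mono_neutral_left) (simp_all add: M_def)
  also have "\<dots> = (\<Sum>z\<in>V. M x z * M z x)"
    using assms by (intro sum.cong refl) (simp add: M_sym power2_eq_square)
  finally show ?thesis
    using assms by (simp add: M_square M_self power2_eq_square power3_eq_cube)
qed

lemma a_le: "x \<in> V \<Longrightarrow> a x y \<le> s * (2 * real n - 3)"
  using card_N[of x] card_mono[OF fin_N[of x], of "N x \<inter> N y"] by (simp add: a_def)

section \<open>The Hoffman bound for cliques\<close>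

definition clique :: "'a set \<Rightarrow> bool" where
  "clique L \<longleftrightarrow> L \<subseteq> V \<and> (\<forall>x\<in>L. L \<subseteq> N x)"

lemma clique_fin: "clique L \<Longrightarrow> finite L"
  by (auto simp: clique_def intro: finite_subset[OF _ fin])

text \<open>A multiple \<open>\<kappa>\<close> of a projection has no eigenvalue above
  \<open>\<kappa>\<close>. Concretely, the squared norm of M - \<open>\<kappa>\<close> I applied to
  the indicator vector of \<open>L\<close> is nonnegative, and M^2 = \<open>\<kappa>\<close> M turns
  this into the claim.\<close>

lemma sum_M_square_le:
  assumes "L \<subseteq> V"
  shows "(\<Sum>x\<in>L. \<Sum>y\<in>L. M x y) \<le> \<kappa> * card L"
proof -
  define h where "h z = (\<Sum>y\<in>L. M z y)" for z
  have fL: "finite L" by (rule finite_subset[OF assms fin])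
  have hL: "(\<Sum>z\<in>V. of_bool (z \<in> L) * f z) = (\<Sum>z\<in>L. f z)" for f :: "'a \<Rightarrow> real"
  proof -
    have "(\<Sum>z\<in>L. f z) = (\<Sum>z\<in>V. if z \<in> L then f z else 0)"
      using assms fin by (intro sum.mono_neutral_cong_left) auto
    thus ?thesis by (auto simp: of_bool_def intro!: sum.cong)
  qed
  have "(\<Sum>z\<in>V. (h z)\<^sup>2) = (\<Sum>z\<in>V. \<Sum>x\<in>L. \<Sum>y\<in>L. M x z * M z y)"
    unfolding h_def power2_eq_square sum_product using assms M_sym
    by (intro sum.cong refl) (auto simp: subset_iff)
  also have "\<dots> = (\<Sum>x\<in>L. \<Sum>z\<in>V. \<Sum>y\<in>L. M x z * M z y)" by (rule sum.swap)
  also have "\<dots> = (\<Sum>x\<in>L. \<Sum>y\<in>L. \<Sum>z\<in>V. M x z * M z y)"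
    by (intro sum.cong refl sum.swap)
  also have "\<dots> = (\<Sum>x\<in>L. \<Sum>y\<in>L. \<kappa> * M x y)"
    using assms by (intro sum.cong refl M_square) auto
  finally have sq: "(\<Sum>z\<in>V. (h z)\<^sup>2) = \<kappa> * (\<Sum>x\<in>L. h x)"
    by (simp add: h_def sum_distrib_left)
  have "0 \<le> (\<Sum>z\<in>V. (h z - \<kappa> * of_bool (z \<in> L))\<^sup>2)" by (intro sum_nonneg) auto
  also have "\<dots> = (\<Sum>z\<in>V. (h z)\<^sup>2 - of_bool (z \<in> L) * (2 * \<kappa> * h z) + of_bool (z \<in> L) * \<kappa>\<^sup>2)"
    by (intro sum.cong refl) (auto simp: power2_diff of_bool_def)
  also have "\<dots> = \<kappa> * (\<Sum>x\<in>L. h x) - 2 * \<kappa> * (\<Sum>x\<in>L. h x) + \<kappa>\<^sup>2 * card L"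
    by (simp only: sum.distrib sum_subtractf hL sq sum_distrib_left[symmetric] sum_constant) simp
  finally have "\<kappa> * (\<Sum>x\<in>L. h x) \<le> \<kappa>\<^sup>2 * card L" by linarith
  hence "\<kappa> * (\<Sum>x\<in>L. h x) \<le> \<kappa> * (\<kappa> * card L)" by (simp only: power2_eq_square[of \<kappa>] mult.assoc)
  moreover have "\<kappa> > 0" using n96 by simp
  ultimately show ?thesis by (simp only: h_def mult_le_cancel_left_pos)
qed

text \<open>A variance argument: with \<open>d z\<close> the number of neighbours of
  \<open>z\<close> on \<open>L\<close>, the sum of \<open>d\<close> is known and the sum of its
  squares is bounded by \<open>sum_M_square_le\<close>. Nonnegativity of the squared deviations
  outside \<open>L\<close> is then a cubic inequality in \<open>l\<close>.\<close>

lemma clique_card_le: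
  assumes L: "clique L"
  shows "real (card L) \<le> s * (real n - 1)"
proof -
  define l where "l = real (card L)"
  define d where "d z = real (card (N z \<inter> L))" for z
  have LV: "L \<subseteq> V" and LN: "\<And>x y. x \<in> L \<Longrightarrow> y \<in> L \<Longrightarrow> y \<in> N x"
    using L by (auto simp: clique_def)
  have fL: "finite L" using L by (rule clique_fin)
  have d_sum: "d z = (\<Sum>x\<in>L. of_bool (z \<in> N x))" if "z \<in> V" for z
    unfolding d_def Int_commute[of "N z"] card_Int_sum[OF fL]
    using that LV by (intro sum.cong refl) (simp add: of_bool_N_sym subset_iff)
  have dL: "d z = l" if "z \<in> L" for z
    using LN[OF that] by (simp add: d_def l_def Int_absorb1 subset_iff)
  have ones: "(\<Sum>z\<in>V. of_bool (z \<in> N x) :: real) = s * (2 * real n - 3)" if "x \<in> V" for x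
    using sum_N_swap[OF that, of "\<lambda>_. 1"] that by (simp add: card_N)
  have "(\<Sum>z\<in>V. d z) = (\<Sum>z\<in>V. \<Sum>x\<in>L. of_bool (z \<in> N x))"
    using d_sum by (intro sum.cong refl)
  also have "\<dots> = (\<Sum>x\<in>L. \<Sum>z\<in>V. of_bool (z \<in> N x))"
    by (rule sum.swap)
  also have "\<dots> = l * (s * (2 * real n - 3))"
    using LV by (simp add: ones subset_iff l_def)
  finally have sum_d: "(\<Sum>z\<in>V. d z) = l * (s * (2 * real n - 3))" .
  have "(\<Sum>z\<in>V. (d z)\<^sup>2) = (\<Sum>z\<in>V. \<Sum>x\<in>L. \<Sum>y\<in>L. of_bool (z \<in> N x) * of_bool (z \<in> N y))"
    by (simp add: d_sum power2_eq_square sum_product del: of_bool_conj)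
  also have "\<dots> = (\<Sum>x\<in>L. \<Sum>z\<in>V. \<Sum>y\<in>L. of_bool (z \<in> N x) * of_bool (z \<in> N y))"
    by (rule sum.swap)
  also have "\<dots> = (\<Sum>x\<in>L. \<Sum>y\<in>L. \<Sum>z\<in>V. of_bool (z \<in> N x) * of_bool (z \<in> N y))"
    by (intro sum.cong refl sum.swap)
  also have "\<dots> = (\<Sum>x\<in>L. \<Sum>y\<in>L. M x y + real s * n)"
    using LV LN by (intro sum.cong refl, subst sum_N_swap) (auto simp: a_sum M_def subset_iff)
  also have "\<dots> \<le> \<kappa> * l + real s * n * l * l"
    using sum_M_square_le[OF LV] by (simp add: sum.distrib l_def mult_ac)
  finally have sum_d2: "(\<Sum>z\<in>V. (d z)\<^sup>2) \<le> \<kappa> * l + real s * n * l * l" .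
  text \<open>In the clique extension every vertex off a line has \<open>2s\<close> neighbours on it.\<close>
  have "0 \<le> (\<Sum>z\<in>V - L. (d z - 2 * s)\<^sup>2)" by (intro sum_nonneg) auto
  also have "\<dots> = (\<Sum>z\<in>V. (d z - 2 * s)\<^sup>2) - (\<Sum>z\<in>L. (d z - 2 * s)\<^sup>2)"
    using sum.subset_diff[OF LV fin, of "\<lambda>z. (d z - 2 * s)\<^sup>2"] by simp
  also have "(\<Sum>z\<in>L. (d z - 2 * s)\<^sup>2) = l * (l - 2 * s)\<^sup>2"
    using dL by (simp add: l_def)
  also have "(\<Sum>z\<in>V. (d z - 2 * s)\<^sup>2) = (\<Sum>z\<in>V. (d z)\<^sup>2) - 4 * s * (\<Sum>z\<in>V. d z) + 4 * (real s)\<^sup>2 * card V"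
    unfolding sum_distrib_left
    by (simp add: power2_diff sum.distrib sum_subtractf power_mult_distrib mult_ac)
  also have "\<dots> - l * (l - 2 * s)\<^sup>2 \<le> \<kappa> * l + real s * n * l * l
      - 4 * s * (l * (s * (2 * real n - 3))) + 4 * (real s)\<^sup>2 * (s * n * (real n - 1) / 2)
      - l * (l - 2 * s)\<^sup>2"
    using sum_d2 by (simp add: sum_d card_V)
  \<comment> \<open>The cubic has the root s(n - 1). The quadratic cofactor is positive by
    completing the square, so the linear factor must be nonnegative.\<close>
  also have "\<dots> = (s * (real n - 1) - l) * (l\<^sup>2 - 5 * s * l + 2 * (real s)\<^sup>2 * n)"
    by (simp add: field_simps power2_eq_square)
  finally have *: "0 \<le> (s * (real n - 1) - l) * (l\<^sup>2 - 5 * s * l + 2 * (real s)\<^sup>2 * n)" by simp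
  have "l\<^sup>2 - 5 * s * l + 2 * (real s)\<^sup>2 * n = (l - 5 / 2 * s)\<^sup>2 + (real s)\<^sup>2 * (2 * n - 25 / 4)"
    by (simp add: field_simps power2_eq_square)
  also have "\<dots> > 0" using n96 by (intro add_nonneg_pos) auto
  finally show ?thesis using * by (simp add: zero_le_mult_iff l_def)
qed

section \<open>Lines\<close>

text \<open>Chebyshev's inequality for row \<open>x\<close> of \<open>M\<close>, whose sum of
  squares is \<open>M_norm\<close>.\<close>

lemma card_large_M:
  fixes t :: real
  assumes "x \<in> V" "T \<subseteq> N x" "\<And>z. z \<in> T \<Longrightarrow> t \<le> \<bar>M x z\<bar>" "0 \<le> t"
  shows "card T * t\<^sup>2 \<le> real s ^ 3 * (real n - 3)\<^sup>2"
proof -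
  have "card T * t\<^sup>2 = (\<Sum>z\<in>T. t\<^sup>2)" by simp
  also have "\<dots> \<le> (\<Sum>z\<in>T. (M x z)\<^sup>2)"
    using assms(3,4) by (intro sum_mono) (simp add: abs_le_square_iff[symmetric])
  also have "\<dots> \<le> (\<Sum>z\<in>N x. (M x z)\<^sup>2)"
    using assms(1,2) by (intro sum_mono2 fin_N) auto
  finally show ?thesis by (simp add: M_norm assms(1))
qed

section \<open>Good neighbours and the absence of claws\<close>

definition good :: "'a \<Rightarrow> 'a set" where
  "good x = {z \<in> N x. \<bar>M x z\<bar> < real s * n / 4}"

lemma good_N: "z \<in> good x \<Longrightarrow> z \<in> N x"
  by (simp add: good_def)

lemma card_bad:
  assumes "x \<in> V"
  shows "real (card (N x - good x)) \<le> 16 * s"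
proof -
  have "card (N x - good x) * (real s * n / 4)\<^sup>2 \<le> real s ^ 3 * (real n - 3)\<^sup>2"
    using assms by (intro card_large_M) (auto simp: good_def)
  also have "\<dots> \<le> real s ^ 3 * (real n)\<^sup>2"
    using n96 by (intro mult_left_mono power_mono) auto
  also have "\<dots> = (16 * s) * (real s * n / 4)\<^sup>2"
    by (simp add: power2_eq_square power3_eq_cube)
  finally show ?thesis
    using n96 by (simp only: mult_le_cancel_right) simp
qed

lemma good_a:
  assumes "z \<in> good x"
  shows "a x z > 3 / 4 * (real s * n)" "a x z < 5 / 4 * (real s * n)"
proof -
  have "\<bar>a x z - real s * n\<bar> < real s * n / 4"
    using assms by (auto simp: good_def M_def split: if_splits)
  thus "a x z > 3 / 4 * (real s * n)" "a x z < 5 / 4 * (real s * n)"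
    unfolding abs_less_iff by linarith+
qed

lemma card_nonadj:
  assumes "x \<in> V" "y \<in> V" "y \<notin> N x"
  shows "card (N x \<inter> N y) = 4 * s"
  using coedge[OF assms] mu by simp

text \<open>Each \<open>N x \<inter> N y\<close> for the three vertices exceeds 3sn/4, and two of
  them share at most 4s vertices. Their union would have more than 9sn/4 - 12s vertices inside
  \<open>N x\<close>, which has only s(2n - 3). Since \<open>N\<close> is closed, nonadjacency here
  includes distinctness.\<close>

lemma no_claw:
  assumes x: "x \<in> V" and y: "y1 \<in> good x" "y2 \<in> good x" "y3 \<in> good x"
    and nonadj: "y2 \<notin> N y1" "y3 \<notin> N y1" "y3 \<notin> N y2"
  shows False
proof -
  have V: "y1 \<in> V" "y2 \<in> V" "y3 \<in> V" using y x by (auto dest: good_N N_in)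
  define A where "A y = N x \<inter> N y" for y
  have fA: "finite (A y)" for y using fin_N[OF x] by (simp add: A_def)
  have le: "card (A y \<inter> A y') \<le> 4 * s" if "y \<in> V" "y' \<in> V" "y' \<notin> N y" for y y'
  proof -
    have "card (A y \<inter> A y') \<le> card (N y \<inter> N y')"
      using fin_N[OF that(1)] by (intro card_mono) (auto simp: A_def)
    thus ?thesis using card_nonadj[OF that] by simp
  qed
  have "card ((A y1 \<union> A y2) \<inter> A y3) \<le> card (A y1 \<inter> A y3) + card (A y2 \<inter> A y3)"
    by (simp add: Int_Un_distrib2 card_Un_le)
  moreover have "card (A y1 \<union> A y2) + card (A y1 \<inter> A y2) = card (A y1) + card (A y2)"
    using card_Un_Int[OF fA fA] by metis
  moreover have "card (A y1 \<union> A y2 \<union> A y3) + card ((A y1 \<union> A y2) \<inter> A y3) = card (A y1 \<union> A y2) + card (A y3)"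
    using card_Un_Int[of "A y1 \<union> A y2" "A y3"] fA by simp
  moreover have "card (A y1 \<union> A y2 \<union> A y3) \<le> card (N x)"
    using fin_N[OF x] by (intro card_mono) (auto simp: A_def)
  moreover note le[OF V(1,2) nonadj(1)] le[OF V(1,3) nonadj(2)] le[OF V(2,3) nonadj(3)]
  ultimately have "card (A y1) + card (A y2) + card (A y3) \<le> card (N x) + 12 * s"
    by linarith
  hence "a x y1 + a x y2 + a x y3 \<le> s * (2 * real n - 3) + 12 * s"
    unfolding card_N[OF x, symmetric] a_def A_def[symmetric] by linarith
  hence "s * (9 / 4 * real n) \<le> s * (2 * real n + 9)"
    using good_a(1)[OF y(1)] good_a(1)[OF y(2)] good_a(1)[OF y(3)] by (simp add: algebra_simps)
  thus False using n96 by (simp only: mult_le_cancel_left_pos)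
qed

section \<open>Maximal cliques\<close>

definition mclique :: "'a set \<Rightarrow> bool" where
  "mclique L \<longleftrightarrow> clique L \<and> (\<forall>L'. clique L' \<longrightarrow> L \<subseteq> L' \<longrightarrow> L = L')"

lemma mclique_clique: "mclique L \<Longrightarrow> clique L"
  by (simp add: mclique_def)

lemma clique_extend:
  assumes "clique C"
  obtains L where "mclique L" "C \<subseteq> L"
proof -
  have "finite {L. clique L}"
    by (rule finite_subset[of _ "Pow V"]) (auto simp: clique_def fin)
  then obtain L where "L \<in> {L. clique L}" "C \<subseteq> L" "\<forall>L'\<in>{L. clique L}. L \<subseteq> L' \<longrightarrow> L = L'"
    using finite_has_maximal2[of "{L. clique L}" C] assms by auto
  thus ?thesis using that[of L] by (auto simp: mclique_def)
qed

lemma clique_insert: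
  assumes "clique C" "x \<in> V" "C \<subseteq> N x"
  shows "clique (insert x C)"
  using assms N_sym[OF assms(2)] N_refl[OF assms(2)] unfolding clique_def by blast

text \<open>By maximality some \<open>u\<close> in \<open>L\<close> is not adjacent to
  \<open>w\<close>, and \<open>L\<close> lies in \<open>N u\<close>; so the neighbours of
  \<open>w\<close> on \<open>L\<close> are among the 4s common neighbours of \<open>w\<close> and
  \<open>u\<close>.\<close>

lemma mclique_outside:
  assumes L: "mclique L" and w: "w \<in> V" "w \<notin> L"
  shows "card (N w \<inter> L) \<le> 4 * s"
proof -
  have cL: "clique L" by (rule mclique_clique[OF L])
  have "\<not> L \<subseteq> N w"
    using clique_insert[OF cL w(1)] L w(2) by (auto simp: mclique_def)
  then obtain u where u: "u \<in> L" "u \<notin> N w" by blast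
  have uV: "u \<in> V" and LN: "L \<subseteq> N u" using cL u by (auto simp: clique_def)
  have "card (N w \<inter> L) \<le> card (N w \<inter> N u)"
    using fin_N[OF w(1)] LN by (intro card_mono) auto
  thus ?thesis using card_nonadj[OF w(1) uV u(2)] by simp
qed

lemma mclique_Int:
  assumes "mclique L" "mclique L'" "L \<noteq> L'"
  shows "card (L \<inter> L') \<le> 4 * s"
proof -
  have "\<not> L' \<subseteq> L" using assms by (auto simp: mclique_def)
  then obtain w where w: "w \<in> L'" "w \<notin> L" by blast
  have wV: "w \<in> V" and N: "L' \<subseteq> N w"
    using mclique_clique[OF assms(2)] w by (auto simp: clique_def)
  have "card (L \<inter> L') \<le> card (N w \<inter> L)"
    using N clique_fin[OF mclique_clique[OF assms(1)]] by (intro card_mono) auto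
  thus ?thesis using mclique_outside[OF assms(1) wV w(2)] by simp
qed

text \<open>A third maximal clique through \<open>x\<close> has at most \<open>4s\<close> vertices on each of two lines and \<open>20s\<close> others.\<close>

definition grand :: "'a set \<Rightarrow> bool" where
  "grand L \<longleftrightarrow> mclique L \<and> 28 * s < card L"

section \<open>The two lines through a vertex\<close>

definition lines :: "'a \<Rightarrow> 'a set set" where
  "lines x = {L. grand L \<and> x \<in> L}"

definition rest :: "'a \<Rightarrow> 'a set" where
  "rest x = N x - \<Union>(lines x)"

text \<open>This contains \<open>x\<close> itself; in the clique extension it is the clique that
  replaces one vertex of T(n).\<close>

definition both :: "'a \<Rightarrow> 'a set" where
  "both x = \<Inter>(lines x)"

lemma lines_sub: "L \<in> lines x \<Longrightarrow> L \<subseteq> N x"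
  by (auto simp: lines_def grand_def mclique_def clique_def)

lemma grand_sub_V: "grand L \<Longrightarrow> L \<subseteq> V"
  by (auto simp: grand_def mclique_def clique_def)

lemma grand_fin: "grand L \<Longrightarrow> finite L"
  by (simp add: grand_def clique_fin mclique_clique)

text \<open>Take two nonadjacent good neighbours \<open>y\<close> and \<open>z\<close> of
  \<open>x\<close>. The good vertices not adjacent to \<open>z\<close> and those not adjacent to
  \<open>y\<close> form two cliques, and these extend to the two lines.\<close>

lemma lines_card:
  assumes x: "x \<in> V"
  obtains L1 L2 where "L1 \<noteq> L2" "lines x = {L1, L2}" "real (card (rest x)) \<le> 20 * s"
proof -
  have fN: "finite (N x)" by (rule fin_N[OF x])
  have gN: "good x \<subseteq> N x" by (auto simp: good_def)
  \<comment> \<open>A good \<open>y\<close> misses at least s(2n - 3) - 5sn/4 vertices of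
    \<open>N x\<close>, of which at most 16s are bad. This ensures both that a suitable
    \<open>z\<close> exists and that the cliques exceed the threshold 28s.\<close>
  have far: "real (card (good x - N y)) > 28 * s" if y: "y \<in> good x" for y
  proof -
    have "card (N x) - card (N x \<inter> N y) \<le> card (good x - N y) + card (N x - good x)"
    proof -
      have "card (N x - N y) \<le> card ((good x - N y) \<union> (N x - good x))"
        using fN gN by (intro card_mono) (auto intro: finite_subset)
      also have "\<dots> \<le> card (good x - N y) + card (N x - good x)" by (rule card_Un_le)
      finally show ?thesis by (simp add: card_Diff_subset_Int fN)
    qed
    hence "real (card (N x)) - a x y \<le> real (card (good x - N y)) + real (card (N x - good x))"
      unfolding a_def by linarith
    moreover have "real s * 28 < s * (3 / 4 * real n - 19)"
      using n96 by (simp only: mult_less_cancel_left_pos)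
    ultimately show ?thesis
      using card_bad[OF x] good_a(2)[OF y] by (simp add: card_N[OF x] algebra_simps)
  qed
  have "good x \<noteq> {}"
  proof
    assume "good x = {}"
    hence "s * (2 * real n - 3) \<le> real s * 16" using card_bad[OF x] by (simp add: card_N[OF x])
    thus False using n96 by (simp only: mult_le_cancel_left_pos)
  qed
  then obtain y where y: "y \<in> good x" by blast
  have "good x - N y \<noteq> {}" using far[OF y] by (metis card.empty of_nat_0 not_less of_nat_0_le_iff mult_nonneg_nonneg zero_le_numeral)
  then obtain z where z: "z \<in> good x" "z \<notin> N y" by blast
  have V: "y \<in> V" "z \<in> V" using y z x by (auto dest: good_N N_in)
  have z': "y \<notin> N z" using z(2) N_sym_iff[OF V] by simp
  \<comment> \<open>Two nonadjacent vertices in \<open>good x - N u\<close> would form a claw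
    together with \<open>u\<close>.\<close>
  have cl: "clique (insert x (good x - N u))" if u: "u \<in> good x" for u
  proof (rule clique_insert)
    have uV: "u \<in> V" using u x by (auto dest: good_N N_in)
    show "clique (good x - N u)"
      unfolding clique_def
    proof (intro conjI ballI subsetI)
      show "w \<in> V" if "w \<in> good x - N u" for w using that x by (auto dest: good_N N_in)
      show "w' \<in> N w" if "w \<in> good x - N u" "w' \<in> good x - N u" for w w'
        using no_claw[OF x u, of w w'] that by blast
    qed
  qed (use x gN in auto)
  obtain L1 where L1: "mclique L1" "insert x (good x - N z) \<subseteq> L1"
    using clique_extend[OF cl[OF z(1)]] by blast
  obtain L2 where L2: "mclique L2" "insert x (good x - N y) \<subseteq> L2"
    using clique_extend[OF cl[OF y]] by blast
  have yL: "y \<in> L1" and zL: "z \<in> L2" using y z z' L1 L2 by auto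
  have ne: "L1 \<noteq> L2"
  proof
    assume "L1 = L2"
    hence "z \<in> N y" using yL zL mclique_clique[OF L2(1)] by (auto simp: clique_def)
    thus False using z by simp
  qed
  have g: "grand L" if "mclique L" "good x - N u \<subseteq> L" "u \<in> good x" for L u
  proof -
    have "card (good x - N u) \<le> card L"
      using that clique_fin[OF mclique_clique] by (intro card_mono) auto
    thus ?thesis using far[OF that(3)] that(1) unfolding grand_def by linarith
  qed
  have g12: "grand L1" "grand L2" using g[of L1 z] g[of L2 y] L1 L2 y z by auto
  \<comment> \<open>A vertex of \<open>N x\<close> missed by both lines is bad (at most 16s) or
    adjacent to both \<open>y\<close> and \<open>z\<close> (4s in number).\<close>
  have cov: "real (card (N x - (L1 \<union> L2))) \<le> 20 * s"
  proof -
    have "card (N x - (L1 \<union> L2)) \<le> card ((N x - good x) \<union> (N y \<inter> N z))"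
      using fN L1(2) L2(2) fin_N[OF V(1)] by (intro card_mono) auto
    also have "\<dots> \<le> card (N x - good x) + card (N y \<inter> N z)" by (rule card_Un_le)
    also have "card (N y \<inter> N z) = 4 * s" by (rule card_nonadj[OF V z(2)])
    finally show ?thesis using card_bad[OF x] by linarith
  qed
  have "lines x = {L1, L2}"
  proof (intro equalityI subsetI)
    fix L assume L: "L \<in> lines x"
    show "L \<in> {L1, L2}"
    proof (rule ccontr)
      assume "L \<notin> {L1, L2}"
      hence n: "L \<noteq> L1" "L \<noteq> L2" by auto
      have m: "mclique L" "28 * s < card L" using L by (auto simp: lines_def grand_def)
      have "card L \<le> card ((L \<inter> L1) \<union> (L \<inter> L2) \<union> (N x - (L1 \<union> L2)))"
        using lines_sub[OF L] fN clique_fin[OF mclique_clique[OF m(1)]] by (intro card_mono) auto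
      also have "\<dots> \<le> card (L \<inter> L1) + card (L \<inter> L2) + card (N x - (L1 \<union> L2))"
        by (meson card_Un_le add_le_mono1 order_trans)
      also have "\<dots> \<le> 4 * s + 4 * s + 20 * s"
        using mclique_Int[OF m(1) L1(1) n(1)] mclique_Int[OF m(1) L2(1) n(2)] cov by linarith
      finally show False using m(2) by simp
    qed
  qed (use g12 L1 L2 in \<open>auto simp: lines_def\<close>)
  thus ?thesis using that[OF ne] cov by (auto simp: rest_def)
qed

section \<open>Vertices on both lines or on none\<close>

lemma Un_lines_sub: "\<Union>(lines x) \<subseteq> N x"
  by (rule Union_least) (rule lines_sub)

lemma Un_lines_fin: "x \<in> V \<Longrightarrow> finite (\<Union>(lines x))"
  by (rule finite_subset[OF Un_lines_sub fin_N])

lemma rest_fin: "x \<in> V \<Longrightarrow> finite (rest x)"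
  by (simp add: rest_def fin_N)

lemma N_decomp: "x \<in> V \<Longrightarrow> N x = \<Union>(lines x) \<union> rest x"
  using Un_lines_sub[of x] unfolding rest_def by blast

lemma mem_Un_lines: "z \<in> \<Union>(lines x) \<longleftrightarrow> x \<in> \<Union>(lines z)"
  by (auto simp: lines_def)

lemma card_lines: "x \<in> V \<Longrightarrow> card (lines x) = 2"
  by (rule lines_card[of x]) simp_all

lemma both_sub:
  assumes "x \<in> V"
  shows "both x \<subseteq> \<Union>(lines x)"
proof -
  obtain L1 L2 where "lines x = {L1, L2}" by (rule lines_card[OF assms])
  thus ?thesis by (auto simp: both_def)
qed

lemma both_lines:
  assumes "x \<in> V" "z \<in> V" "z \<in> both x"
  shows "lines z = lines x"
proof -
  have "lines x \<subseteq> lines z" using assms(3) by (auto simp: both_def lines_def)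
  moreover have "finite (lines z)" using card_lines[OF assms(2)] by (intro card_ge_0_finite) simp
  ultimately show ?thesis
    using card_subset_eq[of "lines z" "lines x"] card_lines[OF assms(1)] card_lines[OF assms(2)] by simp
qed

lemma rest_N_Un:
  assumes x: "x \<in> V" and z: "z \<in> rest x"
  shows "card (N z \<inter> \<Union>(lines x)) \<le> 8 * s"
proof -
  obtain L1 L2 where L: "L1 \<noteq> L2" "lines x = {L1, L2}" by (rule lines_card[OF x])
  have zV: "z \<in> V" "z \<notin> L1" "z \<notin> L2" using z L N_in[OF x] by (auto simp: rest_def)
  have m: "mclique L1" "mclique L2" using L(2) by (auto simp: lines_def grand_def)
  have "N z \<inter> \<Union>(lines x) = (N z \<inter> L1) \<union> (N z \<inter> L2)" using L by auto
  hence "card (N z \<inter> \<Union>(lines x)) \<le> card (N z \<inter> L1) + card (N z \<inter> L2)"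
    by (simp add: card_Un_le)
  thus ?thesis using mclique_outside[OF m(1) zV(1,2)] mclique_outside[OF m(2) zV(1,3)] by simp
qed

lemma a_rest:
  assumes x: "x \<in> V" and z: "z \<in> rest x"
  shows "a x z \<le> 8 * s + card (rest x)"
proof -
  have "card (N x \<inter> N z) \<le> card ((N z \<inter> \<Union>(lines x)) \<union> rest x)"
    using N_decomp[OF x] Un_lines_fin[OF x] rest_fin[OF x] by (intro card_mono) auto
  also have "\<dots> \<le> card (N z \<inter> \<Union>(lines x)) + card (rest x)" by (rule card_Un_le)
  finally show ?thesis using rest_N_Un[OF assms] unfolding a_def by linarith
qed

text \<open>By \<open>both_lines\<close>, \<open>z\<close> has the same lines as \<open>x\<close>,
  so only vertices of \<open>rest x\<close> can fail to be common neighbours.\<close>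

lemma a_both:
  assumes x: "x \<in> V" and z: "z \<in> both x"
  shows "a x z \<ge> s * (2 * real n - 3) - card (rest x)"
proof -
  have zV: "z \<in> V" using both_sub[OF x] N_decomp[OF x] N_in[OF x] z by auto
  have "\<Union>(lines x) \<subseteq> N x \<inter> N z"
    using both_lines[OF x zV z] N_decomp[OF x] N_decomp[OF zV] by auto
  hence "card (\<Union>(lines x)) \<le> card (N x \<inter> N z)"
    using fin_N[OF x] by (intro card_mono) auto
  moreover have "card (N x) \<le> card (\<Union>(lines x)) + card (rest x)"
    using N_decomp[OF x] by (metis card_Un_le)
  ultimately show ?thesis unfolding a_def card_N[OF x, symmetric] by linarith
qed

text \<open>On \<open>rest x\<close> the entries of \<open>M\<close> are at most -s(n - 8 - r), and
  on \<open>both x\<close> at least s(n - 3 - r). All are large in absolute value, so the row norm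
  limits how many there are.\<close>

lemma both_rest_card:
  fixes r :: real
  assumes x: "x \<in> V" and r: "real (card (rest x)) \<le> s * r" and rn: "r \<le> real n - 8"
  shows "(real (card (both x)) + card (rest x)) * (real n - 8 - r)\<^sup>2 \<le> s * (real n - 3)\<^sup>2"
proof -
  have sub: "both x \<subseteq> N x" "rest x \<subseteq> N x"
    using both_sub[OF x] N_decomp[OF x] by auto
  have "both x \<inter> rest x = {}" using both_sub[OF x] by (auto simp: rest_def)
  hence c: "card (both x \<union> rest x) = card (both x) + card (rest x)"
    using sub fin_N[OF x] by (intro card_Un_disjoint) (auto intro: finite_subset)
  have "card (both x \<union> rest x) * (s * (real n - 8 - r))\<^sup>2 \<le> real s ^ 3 * (real n - 3)\<^sup>2"
  proof (intro card_large_M[OF x])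
    fix z assume z: "z \<in> both x \<union> rest x"
    show "s * (real n - 8 - r) \<le> \<bar>M x z\<bar>"
    proof (cases "z \<in> rest x")
      case True
      thus ?thesis using a_rest[OF x True] sub r by (auto simp: M_def algebra_simps)
    next
      case False
      hence "z \<in> both x" using z by simp
      thus ?thesis using a_both[OF x] sub r n96 by (force simp: M_def algebra_simps)
    qed
  qed (use sub rn in auto)
  hence "real s ^ 2 * ((card (both x) + card (rest x)) * (real n - 8 - r)\<^sup>2) \<le> real s ^ 2 * (s * (real n - 3)\<^sup>2)"
    unfolding c by (simp add: power_mult_distrib power2_eq_square power3_eq_cube mult_ac)
  thus ?thesis using n96 by (simp add: mult_le_cancel_left_pos)
qed

text \<open>Two rounds: the crude bound \<open>card (rest x) \<le> 20s\<close> first improves to \<open>2s\<close>, and then to the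
  sharp bound, which is where \<open>n \<ge> 48s\<close> is needed.\<close>

lemma both_rest_le:
  assumes x: "x \<in> V"
  shows "card (both x) + card (rest x) \<le> s"
proof -
  have "real (card (rest x)) \<le> real s * 20" by (rule lines_card[OF x]) simp
  hence "(real (card (both x)) + card (rest x)) * (real n - 8 - 20)\<^sup>2 \<le> s * (real n - 3)\<^sup>2"
    using n96 by (intro both_rest_card[OF x]) auto
  \<comment> \<open>The right side minus the left is (n - 96)(n - 10) + 599.\<close>
  also have "(real n - 3)\<^sup>2 \<le> 2 * (real n - 8 - 20)\<^sup>2"
  proof -
    have "0 \<le> (real n - 96) * (real n - 10) + 599" using n96 by (intro add_nonneg_nonneg mult_nonneg_nonneg) auto
    thus ?thesis by (simp add: power2_eq_square algebra_simps)
  qed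
  hence "s * (real n - 3)\<^sup>2 \<le> real s * 2 * (real n - 8 - 20)\<^sup>2"
    unfolding mult.assoc by (rule mult_left_mono) simp
  finally have "real (card (both x)) + card (rest x) \<le> real s * 2"
    using n96 by (subst (asm) mult_le_cancel_right) auto
  hence "real (card (rest x)) \<le> real s * 2" by linarith
  hence *: "(real (card (both x)) + card (rest x)) * (real n - 8 - 2)\<^sup>2 \<le> s * (real n - 3)\<^sup>2"
    using n96 by (intro both_rest_card[OF x]) auto
  show ?thesis
  proof (rule ccontr)
    assume "\<not> ?thesis"
    hence "real s + 1 \<le> real (card (both x)) + card (rest x)" by linarith
    hence "(real s + 1) * (real n - 8 - 2)\<^sup>2 \<le> s * (real n - 3)\<^sup>2"
      using * by (meson mult_right_mono order_trans zero_le_power2)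
    \<comment> \<open>Subtracting s(n - 10)^2 leaves (n - 3)^2 - (n - 10)^2 = 7(2n - 13) on the
      right; replacing \<open>s\<close> by n/48 then contradicts \<open>n\<close> being at least
      96.\<close>
    hence "(real n - 10)\<^sup>2 \<le> s * (7 * (2 * real n - 13))"
      by (simp add: power2_eq_square algebra_simps)
    also have "\<dots> \<le> n / 48 * (7 * (2 * real n - 13))"
      using n96 by (intro mult_right_mono) auto
    finally have "34 * (real n * real n) + 4800 \<le> 869 * real n"
      by (simp add: power2_eq_square algebra_simps)
    moreover have "96 * real n \<le> real n * real n" using n96 by (intro mult_right_mono) auto
    ultimately show False using n96 by linarith
  qed
qed

section \<open>Row sums of \<open>M\<close> and the exclusion of stray neighbours\<close>

lemma lines_other:
  assumes "x \<in> V" "L \<in> lines x"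
  obtains L' where "L' \<noteq> L" "lines x = {L, L'}"
proof -
  obtain L1 L2 where *: "L1 \<noteq> L2" "lines x = {L1, L2}" by (rule lines_card[OF assms(1)])
  show ?thesis
  proof (cases "L = L1")
    case True thus ?thesis using that[of L2] * by simp
  next
    case False thus ?thesis using that[of L1] * assms(2) by (simp add: insert_commute)
  qed
qed

text \<open>Two lines meeting in \<open>x\<close> are the only lines of \<open>x\<close>, so their
  intersection is \<open>both x\<close>.\<close>

lemma grand_Int:
  assumes "grand L" "grand L'" "L \<noteq> L'"
  shows "card (L \<inter> L') \<le> s"
proof (cases "L \<inter> L' = {}")
  case False
  then obtain x where x: "x \<in> L" "x \<in> L'" by blast
  have xV: "x \<in> V" using grand_sub_V[OF assms(1)] x by blast
  have L: "L \<in> lines x" "L' \<in> lines x" using assms x by (auto simp: lines_def)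
  obtain L'' where "lines x = {L, L''}" by (rule lines_other[OF xV L(1)])
  hence "lines x = {L, L'}" using L(2) assms(3) by auto
  hence "both x = L \<inter> L'" by (simp add: both_def)
  thus ?thesis using both_rest_le[OF xV] by simp
qed simp

text \<open>With \<open>L\<close> the shared line and \<open>L2\<close>, \<open>L3\<close> the other
  lines of \<open>x\<close> and \<open>z\<close>, the common neighbours on lines of both vertices
  lie in \<open>L\<close> or in \<open>L2 \<inter> L3\<close>. These sets have at most s(n - 1) and
  s elements, which the term sn in \<open>M\<close> absorbs; what remains involves
  \<open>rest\<close>.\<close>

lemma M_single:
  assumes x: "x \<in> V" and z: "z \<in> \<Union>(lines x)" "z \<notin> both x"
  shows "M x z \<le> real (card (rest z \<inter> \<Union>(lines x))) + real (card (rest x \<inter> N z))"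
proof -
  have zN: "z \<in> N x" using z Un_lines_sub by blast
  have zV: "z \<in> V" by (rule N_in[OF x zN])
  obtain L where L: "L \<in> lines x" "z \<in> L" using z by blast
  have Lz: "L \<in> lines z" using L by (auto simp: lines_def)
  obtain L2 where L2: "L2 \<noteq> L" "lines x = {L, L2}" by (rule lines_other[OF x L(1)])
  obtain L3 where L3: "L3 \<noteq> L" "lines z = {L, L3}" by (rule lines_other[OF zV Lz])
  have g: "grand L" "grand L2" "grand L3"
    using L2(2) L3(2) by (auto simp: lines_def)
  have "z \<in> L3" using L3(2) by (auto simp: lines_def)
  moreover have "z \<notin> L2" using z(2) L(2) L2(2) by (simp add: both_def)
  ultimately have ne: "L2 \<noteq> L3" by blast
  have fin: "finite L" "finite (L2 \<inter> L3)" "finite (rest z \<inter> \<Union>(lines x))" "finite (rest x \<inter> N z)"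
    using grand_fin[OF g(1)] grand_fin[OF g(2)] rest_fin[OF x] rest_fin[OF zV] by auto
  have "card (N x \<inter> N z) \<le> card (L \<union> (L2 \<inter> L3) \<union> (rest z \<inter> \<Union>(lines x)) \<union> (rest x \<inter> N z))"
    unfolding N_decomp[OF x] N_decomp[OF zV] using fin L2(2) L3(2)
    by (intro card_mono) (auto simp: N_decomp[OF zV])
  also have "\<dots> \<le> card L + card (L2 \<inter> L3) + card (rest z \<inter> \<Union>(lines x)) + card (rest x \<inter> N z)"
    by (meson card_Un_le add_le_mono1 order_trans)
  finally have "a x z \<le> real (card L) + card (L2 \<inter> L3) + card (rest z \<inter> \<Union>(lines x)) + card (rest x \<inter> N z)"
    unfolding a_def by linarith
  moreover have "real (card L) \<le> s * (real n - 1)"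
    using g(1) by (intro clique_card_le mclique_clique) (simp add: grand_def)
  moreover have "card (L2 \<inter> L3) \<le> s" by (rule grand_Int[OF g(2,3) ne])
  ultimately show ?thesis using zN by (simp add: M_def algebra_simps)
qed

text \<open>The row sum \<open>\<kappa>\<close> of \<open>M\<close> is split over
  \<open>rest x\<close>, \<open>both x\<close> and the vertices on exactly one line of
  \<open>x\<close>, and each part is bounded from above.\<close>

lemma row_inequality:
  assumes x: "x \<in> V"
  shows "s * (real n - 3) * (real s - card (both x)) + s * (real n - 17) * card (rest x)
    \<le> (\<Sum>z\<in>\<Union>(lines x). real (card (rest z \<inter> \<Union>(lines x))))"
proof -
  define U where "U = \<Union>(lines x)"
  have fU: "finite U" by (simp add: U_def Un_lines_fin x)
  have fr: "finite (rest x)" by (rule rest_fin[OF x])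
  have bU: "both x \<subseteq> U" using both_sub[OF x] by (simp add: U_def)
  have Nx: "N x = rest x \<union> U" using N_decomp[OF x] by (auto simp: U_def)
  have dis: "rest x \<inter> U = {}" by (auto simp: rest_def U_def)
  have "\<kappa> = (\<Sum>z\<in>N x. M x z)" by (rule sum_M_row[OF x, symmetric])
  also have "\<dots> = (\<Sum>z\<in>rest x. M x z) + (\<Sum>z\<in>U. M x z)"
    unfolding Nx by (rule sum.union_disjoint[OF fr fU dis])
  also have "(\<Sum>z\<in>U. M x z) = (\<Sum>z\<in>U - both x. M x z) + (\<Sum>z\<in>both x. M x z)"
    by (rule sum.subset_diff[OF bU fU])
  also have "(\<Sum>z\<in>both x. M x z) \<le> (\<Sum>z\<in>both x. s * (real n - 3))"
  proof (rule sum_mono)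
    fix z assume "z \<in> both x"
    thus "M x z \<le> s * (real n - 3)"
      using a_le[OF x, of z] bU Nx by (auto simp: M_def algebra_simps)
  qed
  \<comment> \<open>The 9s is 8s from \<open>a_rest\<close> plus at most s for \<open>rest x\<close>
    itself.\<close>
  also have "(\<Sum>z\<in>rest x. M x z) \<le> (\<Sum>z\<in>rest x. 9 * s - real s * n)"
  proof (rule sum_mono)
    fix z assume z: "z \<in> rest x"
    thus "M x z \<le> 9 * s - real s * n"
      using a_rest[OF x z] both_rest_le[OF x] Nx by (auto simp: M_def)
  qed
  also have "(\<Sum>z\<in>U - both x. M x z)
      \<le> (\<Sum>z\<in>U - both x. real (card (rest z \<inter> U)) + real (card (rest x \<inter> N z)))"
    unfolding U_def by (intro sum_mono M_single[OF x]) auto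
  also have "\<dots> \<le> (\<Sum>z\<in>U. real (card (rest z \<inter> U)) + real (card (rest x \<inter> N z)))"
    by (rule sum_mono2[OF fU]) auto
  also have "\<dots> = (\<Sum>z\<in>U. real (card (rest z \<inter> U))) + (\<Sum>z\<in>U. real (card (rest x \<inter> N z)))"
    by (rule sum.distrib)
  \<comment> \<open>Counting edges between \<open>U\<close> and \<open>rest x\<close> from the other
    end costs 8s per vertex of \<open>rest x\<close>; with the 9s above this gives the 17 in the
    statement.\<close>
  also have "(\<Sum>z\<in>U. real (card (rest x \<inter> N z))) = (\<Sum>w\<in>rest x. real (card (U \<inter> N w)))"
  proof -
    have "(\<Sum>z\<in>U. real (card (rest x \<inter> N z))) = (\<Sum>z\<in>U. \<Sum>w\<in>rest x. of_bool (z \<in> N w))"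
      unfolding card_Int_sum[OF fr] using N_in[OF x] Nx
      by (intro sum.cong refl) (simp add: of_bool_N_sym)
    also have "\<dots> = (\<Sum>w\<in>rest x. \<Sum>z\<in>U. of_bool (z \<in> N w))" by (rule sum.swap)
    finally show ?thesis unfolding card_Int_sum[OF fU] .
  qed
  also have "\<dots> \<le> (\<Sum>w\<in>rest x. 8 * real s)"
  proof (rule sum_mono)
    fix w assume "w \<in> rest x"
    thus "real (card (U \<inter> N w)) \<le> 8 * real s"
      using rest_N_Un[OF x, of w] unfolding U_def Int_commute[of _ "N w"] by linarith
  qed
  finally have "\<kappa> \<le> card (rest x) * (9 * s - real s * n) + ((\<Sum>z\<in>U. real (card (rest z \<inter> U)))
      + card (rest x) * (8 * s) + card (both x) * (s * (real n - 3)))"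
    by simp
  thus ?thesis unfolding U_def[symmetric] by (simp add: power2_eq_square algebra_simps)
qed

text \<open>As \<open>w\<close> lies on no line of \<open>z\<close>, the two vertices share no line,
  and each of the four pairs of lines meets in at most \<open>s\<close> vertices.\<close>

lemma Un_lines_Int:
  assumes z: "z \<in> V" and w: "w \<in> rest z"
  shows "card (\<Union>(lines z) \<inter> \<Union>(lines w)) \<le> 4 * s"
proof -
  have wV: "w \<in> V" using w N_in[OF z] by (simp add: rest_def)
  obtain L1 L2 where L: "lines z = {L1, L2}" by (rule lines_card[OF z])
  obtain K1 K2 where K: "lines w = {K1, K2}" by (rule lines_card[OF wV])
  have le: "card (L \<inter> K) \<le> s" if "L \<in> lines z" "K \<in> lines w" for L K
  proof (rule grand_Int)
    show "L \<noteq> K" using that w by (auto simp: rest_def lines_def)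
  qed (use that in \<open>auto simp: lines_def\<close>)
  have "\<Union>(lines z) \<inter> \<Union>(lines w) = (L1 \<inter> K1) \<union> (L1 \<inter> K2) \<union> (L2 \<inter> K1) \<union> (L2 \<inter> K2)"
    by (auto simp: L K)
  also have "card \<dots> \<le> card (L1 \<inter> K1) + card (L1 \<inter> K2) + card (L2 \<inter> K1) + card (L2 \<inter> K2)"
    by (meson card_Un_le add_le_mono1 order_trans)
  also have "\<dots> \<le> s + s + s + s" by (intro add_mono le) (auto simp: L K)
  finally show ?thesis by simp
qed

text \<open>Sum \<open>row_inequality\<close> over all \<open>x\<close>. Its right side counts
  triples with \<open>w\<close> in \<open>rest z\<close> and both \<open>z\<close> and
  \<open>w\<close> on lines of \<open>x\<close>; for fixed \<open>z\<close> and \<open>w\<close>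
  there are at most 4s such \<open>x\<close>. The total size of all \<open>rest x\<close>, times s(n
  - 17 - 4), is therefore at most 0.\<close>

lemma rest_empty:
  assumes "x \<in> V"
  shows "rest x = {}"
proof -
  define U where "U x = \<Union>(lines x)" for x
  have UV: "U x \<subseteq> V" if "x \<in> V" for x
    using Un_lines_sub[of x] N_sub[OF that] by (auto simp: U_def)
  have memU: "of_bool (z \<in> U x) = (of_bool (x \<in> U z) :: real)" for x z
    unfolding U_def by (subst mem_Un_lines) simp
  have rV: "rest z \<subseteq> V" if "z \<in> V" for z using N_sub[OF that] by (auto simp: rest_def)
  have "(\<Sum>x\<in>V. \<Sum>z\<in>U x. real (card (rest z \<inter> U x)))
      = (\<Sum>x\<in>V. \<Sum>z\<in>V. \<Sum>w\<in>rest z. of_bool (x \<in> U z) * of_bool (x \<in> U w))"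
  proof (rule sum.cong[OF refl])
    fix x assume x: "x \<in> V"
    have "(\<Sum>z\<in>U x. real (card (rest z \<inter> U x))) = (\<Sum>z\<in>V. if z \<in> U x then real (card (rest z \<inter> U x)) else 0)"
      using UV[OF x] fin by (intro sum.mono_neutral_cong_left) auto
    also have "\<dots> = (\<Sum>z\<in>V. of_bool (z \<in> U x) * (\<Sum>w\<in>rest z. of_bool (w \<in> U x)))"
      by (intro sum.cong refl) (simp only: card_Int_sum[OF rest_fin] of_bool_def, simp)
    also have "\<dots> = (\<Sum>z\<in>V. \<Sum>w\<in>rest z. of_bool (x \<in> U z) * of_bool (x \<in> U w))"
      unfolding sum_distrib_left memU[of _ x] ..
    finally show "(\<Sum>z\<in>U x. real (card (rest z \<inter> U x))) = \<dots>" .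
  qed
  also have "\<dots> = (\<Sum>z\<in>V. \<Sum>x\<in>V. \<Sum>w\<in>rest z. of_bool (x \<in> U z) * of_bool (x \<in> U w))"
    by (rule sum.swap)
  also have "\<dots> = (\<Sum>z\<in>V. \<Sum>w\<in>rest z. \<Sum>x\<in>V. of_bool (x \<in> U z) * of_bool (x \<in> U w))"
    by (intro sum.cong refl sum.swap)
  also have "\<dots> = (\<Sum>z\<in>V. \<Sum>w\<in>rest z. real (card (U z \<inter> U w)))"
  proof (intro sum.cong refl)
    fix z w assume z: "z \<in> V"
    have "real (card (V \<inter> (U z \<inter> U w))) = (\<Sum>x\<in>V. of_bool (x \<in> U z) * of_bool (x \<in> U w))"
      unfolding card_Int_sum[OF fin] by (intro sum.cong refl) auto
    also have "V \<inter> (U z \<inter> U w) = U z \<inter> U w" using UV[OF z] by blast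
    finally show "(\<Sum>x\<in>V. of_bool (x \<in> U z) * of_bool (x \<in> U w)) = real (card (U z \<inter> U w))" by simp
  qed
  also have "\<dots> \<le> (\<Sum>z\<in>V. \<Sum>w\<in>rest z. real (4 * s))"
    unfolding U_def using Un_lines_Int by (intro sum_mono) (simp only: of_nat_le_iff)
  finally have up: "(\<Sum>x\<in>V. \<Sum>z\<in>U x. real (card (rest z \<inter> U x))) \<le> (\<Sum>z\<in>V. real (card (rest z))) * (4 * s)"
    by (simp add: sum_distrib_right)
  have "(\<Sum>x\<in>V. real (card (rest x))) * (s * (real n - 17)) = (\<Sum>x\<in>V. s * (real n - 17) * card (rest x))"
    unfolding sum_distrib_right by (simp add: mult_ac)
  also have "\<dots> \<le> (\<Sum>x\<in>V. \<Sum>z\<in>U x. real (card (rest z \<inter> U x)))"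
  proof (rule sum_mono)
    fix x assume x: "x \<in> V"
    have "0 \<le> s * (real n - 3) * (real s - card (both x))"
      using both_rest_le[OF x] n96 by (intro mult_nonneg_nonneg) auto
    thus "s * (real n - 17) * card (rest x) \<le> (\<Sum>z\<in>U x. real (card (rest z \<inter> U x)))"
      using row_inequality[OF x] unfolding U_def by linarith
  qed
  also note up
  finally have "(\<Sum>x\<in>V. real (card (rest x))) * (s * (real n - 21)) \<le> 0"
    by (simp add: algebra_simps)
  moreover have "0 < s * (real n - 21)" using n96 by simp
  moreover have "0 \<le> (\<Sum>x\<in>V. real (card (rest x)))" by (rule sum_nonneg) simp
  ultimately have "(\<Sum>x\<in>V. real (card (rest x))) = 0" using n96 by (auto simp: mult_le_0_iff)
  hence "card (rest x) = 0" using assms fin by (simp add: sum_nonneg_eq_0_iff)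
  thus ?thesis using rest_fin[OF assms] by simp
qed

text \<open>Once all \<open>rest\<close> sets are empty, the right side of
  \<open>row_inequality\<close> is 0, which gives the bound opposite to
  \<open>both_rest_le\<close>.\<close>

lemma both_card:
  assumes x: "x \<in> V"
  shows "card (both x) = s"
proof -
  have "(\<Sum>z\<in>\<Union>(lines x). real (card (rest z \<inter> \<Union>(lines x)))) = 0"
  proof (intro sum.neutral ballI)
    fix z assume "z \<in> \<Union>(lines x)"
    hence "z \<in> V" using Un_lines_sub[of x] N_sub[OF x] by blast
    thus "real (card (rest z \<inter> \<Union>(lines x))) = 0" by (simp add: rest_empty)
  qed
  hence "s * (real n - 3) * (real s - card (both x)) \<le> 0"
    using row_inequality[OF x] rest_empty[OF x] by simp
  moreover have "0 < s * (real n - 3)" using n96 by simp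
  ultimately have "real s \<le> card (both x)" using n96 by (auto simp: mult_le_0_iff)
  thus ?thesis using both_rest_le[OF x] by simp
qed

lemma N_eq_Un_lines: "x \<in> V \<Longrightarrow> N x = \<Union>(lines x)"
  using N_decomp rest_empty by simp

text \<open>The two lines of a vertex have s(2n - 3) + s = 2s(n - 1) vertices together, so the
  Hoffman bound is attained by each.\<close>

lemma grand_card:
  assumes L: "grand L"
  shows "real (card L) = s * (real n - 1)"
proof -
  have "L \<noteq> {}" using L by (auto simp: grand_def)
  then obtain x where x: "x \<in> L" by blast
  have xV: "x \<in> V" using grand_sub_V[OF L] x by blast
  have "L \<in> lines x" using L x by (simp add: lines_def)
  then obtain L' where L': "lines x = {L, L'}" by (rule lines_other[OF xV])
  have g: "grand L'" using L' by (auto simp: lines_def)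
  have "card L + card L' = card (L \<union> L') + card (L \<inter> L')"
    by (rule card_Un_Int) (use grand_fin L g in auto)
  moreover have "real (card (L \<union> L')) = s * (2 * real n - 3)"
    using card_N[OF xV] N_eq_Un_lines[OF xV] L' by simp
  moreover have "card (L \<inter> L') = s" using both_card[OF xV] L' by (simp add: both_def)
  moreover have "real (card K) \<le> s * (real n - 1)" if "grand K" for K
    using that by (intro clique_card_le mclique_clique) (simp add: grand_def)
  note this[OF L] this[OF g]
  ultimately show ?thesis by (simp add: algebra_simps)
qed

section \<open>Incidence counts and coordinates\<close>

definition grands :: "'a set set" where "grands = {L. grand L}"

lemma finite_grands: "finite grands"
  by (rule finite_subset[of _ "Pow V"]) (auto simp: grands_def fin grand_sub_V dest: grand_sub_V)

lemma lines_sub_grands: "lines x \<subseteq> grands"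
  by (auto simp: lines_def grands_def)

text \<open>Incidences of vertices and lines are counted twice: two lines per vertex, s(n - 1)
  vertices per line.\<close>

lemma card_grands: "card grands = n"
proof -
  have "(\<Sum>L\<in>grands. real (card L)) = (\<Sum>L\<in>grands. \<Sum>x\<in>V. of_bool (x \<in> L))"
  proof (rule sum.cong[OF refl])
    fix L assume "L \<in> grands"
    hence "V \<inter> L = L" using grand_sub_V by (auto simp: grands_def)
    thus "real (card L) = (\<Sum>x\<in>V. of_bool (x \<in> L))" using card_Int_sum[OF fin, of L] by simp
  qed
  also have "\<dots> = (\<Sum>x\<in>V. \<Sum>L\<in>grands. of_bool (L \<in> lines x))"
    unfolding sum.swap[of _ grands] by (intro sum.cong refl) (auto simp: grands_def lines_def)
  also have "\<dots> = (\<Sum>x\<in>V. 2)"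
    unfolding card_Int_sum[OF finite_grands, symmetric]
    by (intro sum.cong refl) (simp add: card_lines Int_absorb1 lines_sub_grands)
  finally have "(s * (real n - 1)) * card grands = (s * (real n - 1)) * n"
    using grand_card by (simp add: grands_def card_V)
  thus ?thesis using n96 by simp
qed

text \<open>Each vertex of \<open>L\<close> lies on exactly one other line, so the n - 1
  intersections with \<open>L\<close> have total size s(n - 1). None exceeds \<open>s\<close>, hence
  all equal \<open>s\<close>.\<close>

lemma grand_Int_eq:
  assumes L: "grand L" and K: "grand K" "K \<noteq> L"
  shows "card (L \<inter> K) = s"
proof -
  have fL: "finite L" by (rule grand_fin[OF L])
  have "(\<Sum>K\<in>grands - {L}. card (L \<inter> K)) = (\<Sum>K\<in>grands - {L}. \<Sum>x\<in>L. of_bool (x \<in> K))"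
    by (intro sum.cong refl) (simp add: fL Int_def)
  also have "\<dots> = (\<Sum>x\<in>L. \<Sum>K\<in>grands - {L}. of_bool (x \<in> K))" by (rule sum.swap)
  also have "\<dots> = (\<Sum>x\<in>L. 1)"
  proof (intro sum.cong refl)
    fix x assume x: "x \<in> L"
    hence xV: "x \<in> V" using grand_sub_V[OF L] by blast
    have "L \<in> lines x" using x L by (simp add: lines_def)
    have "(\<Sum>K\<in>grands - {L}. of_bool (x \<in> K)) = card ((grands - {L}) \<inter> {K. x \<in> K})"
      using finite_grands by simp
    also have "(grands - {L}) \<inter> {K. x \<in> K} = lines x - {L}" by (auto simp: grands_def lines_def)
    also have "card \<dots> = 1"
      using card_lines[OF xV] \<open>L \<in> lines x\<close> by simp
    finally show "(\<Sum>K\<in>grands - {L}. of_bool (x \<in> K)) = (1::nat)" .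
  qed
  finally have sum: "(\<Sum>K\<in>grands - {L}. card (L \<inter> K)) = card L" by simp
  have LG: "L \<in> grands" "K \<in> grands - {L}" using L K by (auto simp: grands_def)
  have "card (grands - {L}) = n - 1" using card_grands LG finite_grands by simp
  moreover have "card L = (n - 1) * s"
  proof -
    have "real (card L) = real ((n - 1) * s)" using grand_card[OF L] n96 by (simp add: of_nat_diff)
    thus ?thesis by linarith
  qed
  ultimately have "(\<Sum>K\<in>grands - {L}. card (L \<inter> K)) = (\<Sum>K\<in>grands - {L}. s)" using sum by simp
  moreover have le: "card (L \<inter> K') \<le> s" if "K' \<in> grands - {L}" for K'
    using that by (intro grand_Int[OF L]) (auto simp: grands_def)
  ultimately show ?thesis
    using sum_mono_inv[of "\<lambda>K. card (L \<inter> K)" "grands - {L}" "\<lambda>_. s", OF _ le LG(2)] finite_grands by simp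
qed

text \<open>Since a vertex has exactly two lines, the fibre over \<open>{L, K}\<close> is
  \<open>L \<inter> K\<close>.\<close>

lemma fibre_card:
  assumes E: "E \<subseteq> grands" "card E = 2"
  shows "card {x \<in> V. lines x = E} = s"
proof -
  obtain L K where LK: "E = {L, K}" "L \<noteq> K" using E(2) by (auto simp: card_2_iff)
  have g: "grand L" "grand K" using E LK by (auto simp: grands_def)
  have "{x \<in> V. lines x = E} = L \<inter> K"
  proof (intro equalityI subsetI)
    fix x assume x: "x \<in> {x \<in> V. lines x = E}"
    hence "L \<in> lines x" "K \<in> lines x" using LK by auto
    thus "x \<in> L \<inter> K" by (simp add: lines_def)
  next
    fix x assume x: "x \<in> L \<inter> K"
    have xV: "x \<in> V" using x grand_sub_V[OF g(1)] by blast
    have "L \<in> lines x" "K \<in> lines x" using x g by (auto simp: lines_def)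
    moreover obtain L' where "lines x = {L, L'}" by (rule lines_other[OF xV calculation(1)])
    ultimately have "lines x = E" using LK by auto
    thus "x \<in> {x \<in> V. lines x = E}" using xV by simp
  qed
  thus ?thesis using grand_Int_eq[OF g] LK(2) by simp
qed

text \<open>The first coordinate is the pair of numbers of the two lines of a vertex, the second an
  arbitrary numbering of the vertices having these lines. Closed adjacency means sharing a line, so
  equal first coordinates are included.\<close>

lemma triangular_coordinates:
  obtains \<phi> where
    "bij_betw \<phi> V ({e. e \<subseteq> {..<n} \<and> card e = 2} \<times> {..<s})"
    "\<And>x y. x \<in> V \<Longrightarrow> y \<in> V \<Longrightarrow> y \<in> N x \<longleftrightarrow> fst (\<phi> x) \<inter> fst (\<phi> y) \<noteq> {}"
proof -
  obtain g where g: "bij_betw g grands {..<n}"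
    using ex_bij_betw_finite_nat[OF finite_grands] card_grands by (auto simp: atLeast0LessThan)
  have gi: "inj_on g grands" and gG: "g ` grands = {..<n}" using g by (auto simp: bij_betw_def)
  define F where "F E = {x \<in> V. lines x = E}" for E
  have finF: "finite (F E)" for E using fin by (simp add: F_def)
  have "\<exists>h. \<forall>E. E \<subseteq> grands \<and> card E = 2 \<longrightarrow> bij_betw (h E) (F E) {..<s}"
  proof (intro choice allI)
    fix E
    show "\<exists>h. E \<subseteq> grands \<and> card E = 2 \<longrightarrow> bij_betw h (F E) {..<s}"
      using ex_bij_betw_finite_nat[OF finF[of E]] fibre_card[of E]
      by (auto simp: F_def atLeast0LessThan)
  qed
  then obtain h where h: "\<And>E. E \<subseteq> grands \<Longrightarrow> card E = 2 \<Longrightarrow> bij_betw (h E) (F E) {..<s}" by blast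
  define \<phi> where "\<phi> x = (g ` lines x, h (lines x) x)" for x
  have hx: "bij_betw (h (lines x)) (F (lines x)) {..<s}" if "x \<in> V" for x
    by (rule h[OF lines_sub_grands card_lines[OF that]])
  have "inj_on \<phi> V"
  proof (rule inj_onI)
    fix x y assume V: "x \<in> V" "y \<in> V" and eq: "\<phi> x = \<phi> y"
    have "g ` lines x = g ` lines y" using eq by (simp add: \<phi>_def)
    hence l: "lines x = lines y" using inj_on_image_eq_iff[OF gi lines_sub_grands lines_sub_grands] by blast
    have "h (lines x) x = h (lines x) y" using eq l by (simp add: \<phi>_def)
    moreover have "x \<in> F (lines x)" "y \<in> F (lines x)" using V l by (auto simp: F_def)
    ultimately show "x = y" using hx[OF V(1)] by (auto simp: bij_betw_def dest: inj_onD)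
  qed
  moreover have "\<phi> ` V = {e. e \<subseteq> {..<n} \<and> card e = 2} \<times> {..<s}"
  proof (intro equalityI subsetI)
    fix p assume "p \<in> \<phi> ` V"
    then obtain x where x: "x \<in> V" "p = \<phi> x" by blast
    have "g ` lines x \<subseteq> {..<n}" using lines_sub_grands gG by blast
    moreover have "card (g ` lines x) = 2"
      using card_image[OF inj_on_subset[OF gi lines_sub_grands]] card_lines[OF x(1)] by simp
    moreover have "h (lines x) x \<in> {..<s}"
      using hx[OF x(1)] x(1) by (auto simp: bij_betw_def F_def)
    ultimately show "p \<in> {e. e \<subseteq> {..<n} \<and> card e = 2} \<times> {..<s}" by (simp add: x(2) \<phi>_def)
  next
    fix p assume p: "p \<in> {e. e \<subseteq> {..<n} \<and> card e = 2} \<times> {..<s}"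
    obtain e i where ei: "p = (e, i)" "e \<subseteq> {..<n}" "card e = 2" "i < s" using p by auto
    obtain E where E: "E \<subseteq> grands" "e = g ` E" using ei(2) gG by (metis subset_image_iff)
    have "card E = 2" using ei(3) E card_image[OF inj_on_subset[OF gi E(1)]] by simp
    hence "h E ` F E = {..<s}" using h[OF E(1)] by (simp add: bij_betw_def)
    then obtain x where x: "x \<in> F E" "h E x = i" using ei(4) by (metis imageE lessThan_iff)
    hence "x \<in> V" "\<phi> x = p" using ei(1) E(2) by (auto simp: F_def \<phi>_def)
    thus "p \<in> \<phi> ` V" by blast
  qed
  ultimately have "bij_betw \<phi> V ({e. e \<subseteq> {..<n} \<and> card e = 2} \<times> {..<s})" by (simp add: bij_betw_def)
  moreover have "y \<in> N x \<longleftrightarrow> fst (\<phi> x) \<inter> fst (\<phi> y) \<noteq> {}" if "x \<in> V" "y \<in> V" for x y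
  proof -
    have "y \<in> N x \<longleftrightarrow> lines x \<inter> lines y \<noteq> {}"
      unfolding N_eq_Un_lines[OF that(1)] by (auto simp: lines_def)
    also have "\<dots> \<longleftrightarrow> g ` (lines x \<inter> lines y) \<noteq> {}" by simp
    also have "g ` (lines x \<inter> lines y) = fst (\<phi> x) \<inter> fst (\<phi> y)"
      unfolding \<phi>_def fst_conv by (rule inj_on_image_Int[OF gi lines_sub_grands lines_sub_grands])
    finally show ?thesis .
  qed
  ultimately show ?thesis by (rule that)
qed
end

section \<open>From the graph to its closed neighbourhoods\<close>

definition closed_nbhd :: "'a pair_pre_digraph \<Rightarrow> 'a \<Rightarrow> 'a set" where
  "closed_nbhd G x = insert x {y. (x, y) \<in> parcs G}"

context pair_graph begin

lemma closed_nbhd_sub: "x \<in> pverts G \<Longrightarrow> closed_nbhd G x \<subseteq> pverts G"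
  using in_arcsD2 by (auto simp: closed_nbhd_def)

lemma closed_nbhd_sym: "y \<in> closed_nbhd G x \<Longrightarrow> x \<in> closed_nbhd G y"
  using arcs_symmetric by (auto simp: closed_nbhd_def)

lemma closed_nbhd_sym_iff: "x \<in> closed_nbhd G y \<longleftrightarrow> y \<in> closed_nbhd G x"
  using closed_nbhd_sym by blast

lemma closed_nbhd_fin: "x \<in> pverts G \<Longrightarrow> finite (closed_nbhd G x)"
  using finite_subset[OF closed_nbhd_sub pair_finite_verts] .

lemma card_closed_nbhd:
  assumes "x \<in> pverts G"
  shows "card (closed_nbhd G x) = Suc (out_degree (with_proj G) x)"
proof -
  have "out_arcs (with_proj G) x = Pair x ` {y. (x, y) \<in> parcs G}"
    by (auto simp: out_arcs_def)
  hence "out_degree (with_proj G) x = card {y. (x, y) \<in> parcs G}"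
    by (simp add: out_degree_def card_image inj_on_def)
  moreover have "finite {y. (x, y) \<in> parcs G}"
    by (rule finite_subset[OF _ closed_nbhd_fin[OF assms]]) (auto simp: closed_nbhd_def)
  moreover have "x \<notin> {y. (x, y) \<in> parcs G}" using no_loops' by blast
  ultimately show ?thesis by (simp add: closed_nbhd_def)
qed

end

text \<open>Adding the identity shifts the eigenvalues to s(2n - 3), s(n - 3), -s and 0. The rows of
  \<open>C\<close> are indicators of closed neighbourhoods, so the entries of C^2 count common
  neighbours and the cubic identity becomes \<open>walk3\<close>.\<close>

lemma triangular_spectrum_closed_nbhd:
  assumes s: "s \<ge> 2" and G: "pair_graph \<Gamma>" and co: "co_edge_regular \<Gamma>"
    and spec: "graph_spectrum \<Gamma> =
           replicate_mset 1 (2 * real s * real n - 3 * real s - 1)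
         + replicate_mset (n - 1) (real s * real n - 3 * real s - 1)
         + replicate_mset ((n\<^sup>2 - 3 * n) div 2) (- real s - 1)
         + replicate_mset ((s - 1) * n * (n - 1) div 2) (- 1)"
    and n: "n \<ge> 48 * s"
  shows "\<exists>\<mu>. triangular_spectrum (pverts \<Gamma>) (closed_nbhd \<Gamma>) s n \<mu>"
proof -
  interpret pair_graph \<Gamma> by (rule G)
  let ?V = "pverts \<Gamma>" and ?N = "closed_nbhd \<Gamma>"
  obtain xs where xs: "distinct xs" "set xs = ?V"
    using finite_distinct_list[OF pair_finite_verts] by blast
  define m where "m = length xs"
  have mV: "m = card ?V" using distinct_card[OF xs(1)] xs(2) by (simp add: m_def)
  have xV: "xs ! i \<in> ?V" if "i < m" for i
    using nth_mem[of i xs] that unfolding xs(2) m_def .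
  define A where "A = adjacency_matrix xs \<Gamma>"
  have cA: "A \<in> carrier_mat m m" by (simp add: A_def adjacency_matrix_def m_def)
  have Aij: "A $$ (i, j) = of_bool ((xs ! i, xs ! j) \<in> parcs \<Gamma>)" if "i < m" "j < m" for i j
    using that by (simp add: A_def adjacency_matrix_def m_def)
  have Asym: "A $$ (j, i) = A $$ (i, j)" if "i < m" "j < m" for i j
  proof -
    have "(xs ! j, xs ! i) \<in> parcs \<Gamma> \<longleftrightarrow> (xs ! i, xs ! j) \<in> parcs \<Gamma>"
      using arcs_symmetric by blast
    thus ?thesis using that by (simp add: Aij)
  qed
  obtain U P Q where U: "similar_mat_wit A U P Q" "upper_triangular U"
    "mset (diag_mat U) = proots (char_poly A)"
    by (rule symmetric_real_triangularizable[OF cA Asym])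
  have cU: "U \<in> carrier_mat m m"
    by (rule similar_mat_witD(5)[OF _ U(1)]) (use cA in simp)
  define C where "C = A + 1 \<cdot>\<^sub>m 1\<^sub>m m"
  define T where "T = U + 1 \<cdot>\<^sub>m 1\<^sub>m m"
  have cC: "C \<in> carrier_mat m m" and cT: "T \<in> carrier_mat m m"
    using cA cU by (simp_all add: C_def T_def)
  have simC: "similar_mat_wit C T P Q"
    unfolding C_def T_def by (rule similar_mat_wit_add_smult_one[OF U(1) cA])
  have utT: "upper_triangular T"
    using U(2) cU by (auto simp: T_def upper_triangular_def)
  have "diag_mat T = map (\<lambda>u. u + 1) (diag_mat U)"
    using cU by (auto simp: diag_mat_def T_def)
  hence "mset (diag_mat T) = image_mset (\<lambda>u. u + 1) (graph_spectrum \<Gamma>)"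
    using U(3) graph_spectrum_eq[OF xs] by (simp add: A_def)
  hence specT: "mset (diag_mat T) = replicate_mset 1 (s * (2 * real n - 3))
      + replicate_mset (n - 1) (s * (real n - 3)) + replicate_mset ((n\<^sup>2 - 3 * n) div 2) (- real s)
      + replicate_mset ((s - 1) * n * (n - 1) div 2) 0"
    by (simp add: spec algebra_simps)
  have n96: "real n \<ge> 96" "n \<ge> 96" using s n by linarith+
  \<comment> \<open>The multiplicities are natural-number quotients; the numerators are even, so
    passing to the reals loses nothing.\<close>
  have b: "real ((n\<^sup>2 - 3 * n) div 2) = real n * (real n - 3) / 2"
  proof -
    have "n\<^sup>2 - 3 * n = n * (n - 3)" by (simp add: power2_eq_square diff_mult_distrib2 mult.commute)
    moreover have "even (n * (n - 3))" using n96 by (auto simp: even_diff_nat)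
    ultimately show ?thesis using n96 by (simp add: real_of_nat_div of_nat_diff)
  qed
  have c: "real ((s - 1) * n * (n - 1) div 2) = (real s - 1) * real n * (real n - 1) / 2"
  proof -
    have "even ((s - 1) * n * (n - 1))" using n96 by auto
    thus ?thesis using n96 s by (simp add: real_of_nat_div of_nat_diff)
  qed
  have "m = size (mset (diag_mat T))" using cT by (simp add: diag_mat_def)
  hence "real m = real 1 + real (n - 1) + real ((n\<^sup>2 - 3 * n) div 2) + real ((s - 1) * n * (n - 1) div 2)"
    unfolding specT by simp
  hence m: "real m = s * n * (real n - 1) / 2"
    unfolding b c using n96 by (simp add: of_nat_diff field_simps)
  have m0: "m > 0" using m n96 s by (intro gr0I) auto
  have Cij: "C $$ (i, j) = of_bool (xs ! j \<in> ?N (xs ! i))" if "i < m" "j < m" for i j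
  proof -
    have "xs ! i = xs ! j \<longleftrightarrow> i = j"
      using that xs(1) by (simp add: nth_eq_iff_index_eq m_def)
    thus ?thesis
      using that cA no_loops'[of "xs ! i" "xs ! j"] by (auto simp: C_def Aij closed_nbhd_def)
  qed
  have bij: "bij_betw (nth xs) {..<m} ?V"
    using bij_betw_nth[OF xs(1), of "{..<m}" ?V] xs(2) by (simp add: m_def)
  have sumN: "(\<Sum>k<m. C $$ (i, k) * f (xs ! k)) = (\<Sum>z\<in>?N (xs ! i). f z)"
    if "i < m" for i and f :: "'a \<Rightarrow> real"
  proof -
    have "(\<Sum>k<m. C $$ (i, k) * f (xs ! k)) = (\<Sum>k<m. of_bool (xs ! k \<in> ?N (xs ! i)) * f (xs ! k))"
      using that by (intro sum.cong refl) (simp add: Cij)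
    also have "\<dots> = (\<Sum>z\<in>?V. of_bool (z \<in> ?N (xs ! i)) * f z)"
      by (rule sum.reindex_bij_betw[OF bij])
    also have "\<dots> = (\<Sum>z\<in>?N (xs ! i). f z)"
      using closed_nbhd_sub[OF xV[OF that]] pair_finite_verts
      by (intro sum.mono_neutral_cong_right) auto
    finally show ?thesis .
  qed
  have C2: "(\<Sum>l<m. C $$ (i, l) * C $$ (l, j)) = real (card (?N (xs ! i) \<inter> ?N (xs ! j)))"
    if "i < m" "j < m" for i j
  proof -
    have "(\<Sum>l<m. C $$ (i, l) * C $$ (l, j)) = (\<Sum>l<m. C $$ (i, l) * of_bool (xs ! l \<in> ?N (xs ! j)))"
      using that by (intro sum.cong refl) (simp add: Cij closed_nbhd_sym_iff)
    also have "\<dots> = (\<Sum>z\<in>?N (xs ! i). of_bool (z \<in> ?N (xs ! j)))" by (rule sumN[OF that(1)])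
    finally show ?thesis unfolding card_Int_sum[OF closed_nbhd_fin[OF xV[OF that(1)]]] .
  qed
  obtain d where d: "\<And>x. x \<in> ?V \<Longrightarrow> out_degree (with_proj \<Gamma>) x = d"
    using co by (auto simp: co_edge_regular_def regular_graph_def)
  have Csym: "C $$ (j, i) = C $$ (i, j)" if "i < m" "j < m" for i j
    using that by (simp add: Cij closed_nbhd_sym_iff)
  \<comment> \<open>The degree comes from a trace, without Perron-Frobenius: every diagonal entry of
    C^2 is \<open>d + 1\<close>, and the trace is the sum of the squared eigenvalues.\<close>
  have "mat_trace (C * C) = mat_trace (T * T)"
    by (rule mat_trace_similar[OF similar_mat_wit_mult[OF simC simC]])
  moreover have "mat_trace (C * C) = m * (real d + 1)"
    using cC xV by (simp add: mat_trace_def index_mult_mat_sum[OF cC cC] C2 card_closed_nbhd d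
        del: index_mult_mat(1))
  moreover have "mat_trace (T * T) = (\<Sum>i<m. (T $$ (i, i))\<^sup>2)"
    using cT by (simp add: mat_trace_def upper_triangular_mult(2)[OF cT utT cT utT] power2_eq_square
        del: index_mult_mat(1))
  moreover have "\<dots> = (s * (2 * real n - 3))\<^sup>2 + real (n - 1) * (s * (real n - 3))\<^sup>2
      + real ((n\<^sup>2 - 3 * n) div 2) * (real s)\<^sup>2"
    unfolding sum_diag_mat[OF cT, of "\<lambda>u. u\<^sup>2"] specT by simp
  ultimately have "m * (real d + 1) = m * (s * (2 * real n - 3))"
    unfolding b m using n96 by (simp add: of_nat_diff field_simps power2_eq_square)
  hence d1: "real d + 1 = s * (2 * real n - 3)" using m0 by simp
  have cN: "real (card (?N x)) = s * (2 * real n - 3)" if "x \<in> ?V" for x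
    using card_closed_nbhd[OF that] d[OF that] d1 by simp
  have row: "(\<Sum>j<m. C $$ (i, j)) = s * (2 * real n - 3)" if "i < m" for i
    using sumN[OF that, of "\<lambda>_. 1"] cN[OF xV[OF that]] by simp
  obtain \<mu> where \<mu>: "\<And>x y. x \<in> ?V \<Longrightarrow> y \<in> ?V \<Longrightarrow> x \<noteq> y \<and> (x, y) \<notin> parcs \<Gamma> \<Longrightarrow>
      card {z \<in> ?V. (x, z) \<in> parcs \<Gamma> \<and> (y, z) \<in> parcs \<Gamma>} = \<mu>"
    using co unfolding co_edge_regular_def by blast
  have "triangular_spectrum ?V ?N s n \<mu>"
  proof
    show "finite ?V" by (rule pair_finite_verts)
    show "?V \<noteq> {}" using m0 mV by auto
    show "?N x \<subseteq> ?V" if "x \<in> ?V" for x by (rule closed_nbhd_sub[OF that])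
    show "x \<in> ?N x" for x by (simp add: closed_nbhd_def)
    show "x \<in> ?N y" if "y \<in> ?N x" for x y by (rule closed_nbhd_sym[OF that])
    show "2 \<le> s" "48 * s \<le> n" by fact+
    show "real (card ?V) = s * n * (real n - 1) / 2" using m mV by simp
    show "real (card (?N x)) = s * (2 * real n - 3)" if "x \<in> ?V" for x by (rule cN[OF that])
  next
    fix x y assume xy: "x \<in> ?V" "y \<in> ?V" "y \<notin> ?N x"
    hence "?N x \<inter> ?N y = {z \<in> ?V. (x, z) \<in> parcs \<Gamma> \<and> (y, z) \<in> parcs \<Gamma>}"
      using closed_nbhd_sym[of x y] in_arcsD2 by (auto simp: closed_nbhd_def)
    thus "card (?N x \<inter> ?N y) = \<mu>" using \<mu>[OF xy(1,2)] xy(3) by (auto simp: closed_nbhd_def)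
  next
    fix x y assume xy: "x \<in> ?V" "y \<in> ?V"
    obtain i j where ij: "i < m" "x = xs ! i" "j < m" "y = xs ! j"
      using xy xs(2) by (metis in_set_conv_nth m_def)
    let ?t = "s * (real n - 3)" and ?K = "s * (2 * real n - 3)"
    have "(\<Sum>z\<in>?N x. real (card (?N z \<inter> ?N y))) = (\<Sum>k<m. C $$ (i, k) * (\<Sum>l<m. C $$ (k, l) * C $$ (l, j)))"
      unfolding ij sumN[OF ij(1), symmetric] using ij(3) by (intro sum.cong refl) (simp add: C2)
    also have "\<dots> = (?t - s) * (\<Sum>l<m. C $$ (i, l) * C $$ (l, j)) + ?t * s * C $$ (i, j)
         + (?K - ?t) * (?K + s) * ?K / m"
      by (rule symmetric_cubic_identity[OF cC Csym row simC utT specT ij(1,3)])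
    \<comment> \<open>The factors are \<open>?K - ?t\<close> = sn and \<open>?K + s\<close> = 2s(n -
      1), and their product is 4s times \<open>m\<close>.\<close>
    also have "(?K - ?t) * (?K + s) * ?K / m = 4 * s\<^sup>2 * (2 * real n - 3)"
      unfolding m using n96 s by (simp add: field_simps power2_eq_square)
    finally show "(\<Sum>z\<in>?N x. real (card (?N z \<inter> ?N y))) =
       s * (real n - 4) * real (card (?N x \<inter> ?N y)) + s\<^sup>2 * (real n - 3) * of_bool (y \<in> ?N x)
       + 4 * s\<^sup>2 * (2 * real n - 3)"
      unfolding C2[OF ij(1,3)] Cij[OF ij(1,3)] ij(2,4)[symmetric]
      by (simp add: power2_eq_square algebra_simps)
  qed
  thus ?thesis by blast
qed

section \<open>The isomorphism with the clique extension\<close>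

lemma digraph_iso_with_projI:
  assumes "pair_wf_digraph G" "bij_betw \<phi> (pverts G) (pverts H)"
    and "parcs H = map_prod \<phi> \<phi> ` parcs G"
  shows "digraph_iso (with_proj G) (with_proj H)"
proof -
  interpret pair_wf_digraph G by fact
  \<comment> \<open>Arcs are pairs of vertices, so the arc map is
    \<open>map_prod \<phi> \<phi>\<close> and head and tail stay the projections.\<close>
  define f where "f = \<lparr>iso_verts = \<phi>, iso_arcs = map_prod \<phi> \<phi>, iso_head = snd, iso_tail = fst\<rparr>"
  have inj: "inj_on \<phi> (pverts G)" using assms(2) by (simp add: bij_betw_def)
  have "parcs G \<subseteq> pverts G \<times> pverts G" using wellformed' by auto
  hence "inj_on (map_prod \<phi> \<phi>) (parcs G)"
    using inj_on_subset[OF map_prod_inj_on[OF inj inj]] by blast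
  hence "digraph_isomorphism f"
    unfolding digraph_isomorphism_def
    using inj wf_digraph_axioms by (simp add: f_def)
  moreover have "with_proj H = app_iso f (with_proj G)"
    using assms(2,3) by (simp add: app_iso_def f_def with_proj_def bij_betw_def)
  ultimately show ?thesis unfolding digraph_iso_def by blast
qed

text \<open>This translates meeting of coordinates, a closed relation, into equality or adjacency in
  T(n).\<close>

lemma card_two_Int:
  assumes "card e = 2" "card f = 2"
  shows "e \<inter> f \<noteq> {} \<longleftrightarrow> e = f \<or> card (e \<inter> f) = 1"
proof -
  obtain a b c d where "e = {a, b}" "a \<noteq> b" "f = {c, d}" "c \<noteq> d"
    using assms by (auto simp: card_2_iff)
  thus ?thesis by (auto simp: Int_insert_left)
qed

theorem theorem1p1:
  fixes s n :: nat and \<Gamma> :: "'a pair_pre_digraph"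
  assumes "s \<ge> 2" and "n \<ge> 1"
    and "pair_graph \<Gamma>"
    and "co_edge_regular \<Gamma>"
    and "graph_spectrum \<Gamma> =
           replicate_mset 1 (2 * real s * real n - 3 * real s - 1)
         + replicate_mset (n - 1) (real s * real n - 3 * real s - 1)
         + replicate_mset ((n\<^sup>2 - 3 * n) div 2) (- real s - 1)
         + replicate_mset ((s - 1) * n * (n - 1) div 2) (- 1)"
    and "n \<ge> 48 * s"
  shows "digraph_iso (with_proj \<Gamma>) (with_proj (clique_extension s (triangular_graph n)))"
proof -
  interpret G: pair_graph \<Gamma> by fact
  let ?H = "clique_extension s (triangular_graph n)"
  obtain \<mu> where "triangular_spectrum (pverts \<Gamma>) (closed_nbhd \<Gamma>) s n \<mu>"
    using triangular_spectrum_closed_nbhd[OF assms(1,3-6)] by blast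
  then interpret triangular_spectrum "pverts \<Gamma>" "closed_nbhd \<Gamma>" s n \<mu> .
  obtain \<phi> where \<phi>: "bij_betw \<phi> (pverts \<Gamma>) ({e. e \<subseteq> {..<n} \<and> card e = 2} \<times> {..<s})"
    and adj: "\<And>x y. x \<in> pverts \<Gamma> \<Longrightarrow> y \<in> pverts \<Gamma> \<Longrightarrow>
        y \<in> closed_nbhd \<Gamma> x \<longleftrightarrow> fst (\<phi> x) \<inter> fst (\<phi> y) \<noteq> {}"
    by (rule triangular_coordinates) (rule that, assumption, blast)
  have H: "pverts ?H = {e. e \<subseteq> {..<n} \<and> card e = 2} \<times> {..<s}"
    by (simp add: clique_extension_def triangular_graph_def)
  have arc: "(\<phi> x, \<phi> y) \<in> parcs ?H \<longleftrightarrow> (x, y) \<in> parcs \<Gamma>"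
    if "x \<in> pverts \<Gamma>" "y \<in> pverts \<Gamma>" for x y
  proof -
    obtain e i f j where e: "\<phi> x = (e, i)" and f: "\<phi> y = (f, j)" by fastforce
    have mem: "(e, i) \<in> pverts ?H" "(f, j) \<in> pverts ?H"
      using \<phi> that e f H by (metis bij_betwE)+
    have "(x, y) \<in> parcs \<Gamma> \<longleftrightarrow> x \<noteq> y \<and> y \<in> closed_nbhd \<Gamma> x"
      using G.no_loops' by (auto simp: closed_nbhd_def)
    also have "\<dots> \<longleftrightarrow> (e, i) \<noteq> (f, j) \<and> e \<inter> f \<noteq> {}"
      using adj[OF that] e f inj_on_eq_iff[OF bij_betw_imp_inj_on[OF \<phi>] that] by simp
    \<comment> \<open>The first case is adjacency inside one of the substituted cliques, the second
      adjacency inherited from T(n).\<close>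
    also have "\<dots> \<longleftrightarrow> e = f \<and> i \<noteq> j \<or> card (e \<inter> f) = 1"
      using mem card_two_Int[of e f] by (auto simp: H)
    also have "\<dots> \<longleftrightarrow> ((e, i), (f, j)) \<in> parcs ?H"
      using mem by (auto simp: H) (auto simp: clique_extension_def triangular_graph_def)
    finally show ?thesis by (simp add: e f)
  qed
  show ?thesis
  proof (rule digraph_iso_with_projI)
    show "pair_wf_digraph \<Gamma>" ..
    show "bij_betw \<phi> (pverts \<Gamma>) (pverts ?H)" using \<phi> H by simp
    interpret H: pair_graph ?H
      by (rule pair_graph_clique_extension[OF pair_graph_triangular_graph])
    have im: "pverts ?H = \<phi> ` pverts \<Gamma>" using \<phi> H by (simp add: bij_betw_def)
    show "parcs ?H = map_prod \<phi> \<phi> ` parcs \<Gamma>"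
    proof (intro equalityI subsetI)
      fix p assume p: "p \<in> parcs ?H"
      obtain u v where uv: "p = (u, v)" by (cases p)
      have "u \<in> pverts ?H" "v \<in> pverts ?H" using p uv H.wellformed' by auto
      then obtain x y where xy: "x \<in> pverts \<Gamma>" "y \<in> pverts \<Gamma>" "u = \<phi> x" "v = \<phi> y"
        unfolding im by blast
      hence "(x, y) \<in> parcs \<Gamma>" using arc p uv by blast
      thus "p \<in> map_prod \<phi> \<phi> ` parcs \<Gamma>" using xy uv by (auto intro!: rev_image_eqI)
    next
      fix p assume "p \<in> map_prod \<phi> \<phi> ` parcs \<Gamma>"
      then obtain x y where "(x, y) \<in> parcs \<Gamma>" "p = (\<phi> x, \<phi> y)" by auto
      thus "p \<in> parcs ?H" using arc G.wellformed' by blast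
    qed
  qed
qed

end
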